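(* Let $G$ be a finite group whose inequivalent irreducible unitary representations are $\pi^1,\dots,\pi^k$, let $J\ge 0$ be an integer, and let $\{\gamma_j:\{1,\ldots,k\}\to\mathbb{C}\}_{0\le j\le J}$ be a family of functions with associated $G$-wavelets $\psi_{\gamma_j}$. For $r\in\{1,\dots,k\}$ put $$C(r)=\sum_{j=0}^{J}|\gamma_j(r)|^2 .$$ Let $0<A\le B<\infty$. The following are equivalent: (i) The set $\{L(h)\psi_{\gamma_j} : 0\le j\le J,\ h\in G\}$ is a frame of $L^2(G)$ with constants $A,B$, i.e. $$A\|f\|^2\le \frac{1}{|G|}\sum_{h\in G}\sum_{j=0}^{J}|\langle f, L(h)\psi_{\gamma_j}\rangle|^2\le B\|f\|^2\quad\text{for all } f\in L^2(G).$$ (ii) $A\le C(r)\le B$ for all $r\in\{1,\dots,k\}$.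
   Context: $G$ is a finite group (not necessarily abelian). $L^2(G)$ is the space of all functions $f:G\to\mathbb{C}$ with inner product $\langle f,g\rangle=\frac{1}{|G|}\sum_{x\in G}f(x)\overline{g(x)}$ and induced norm $\|f\|=\langle f,f\rangle^{1/2}$. The left regular representation is $L(h)f(x)=f(h^{-1}x)$. $\pi^1,\dots,\pi^k$ is a complete system of pairwise inequivalent irreducible unitary representations of $G$ ($k$ is the number of conjugacy classes of $G$), $d_r$ is the degree (dimension) of $\pi^r$ and $\chi^r(x)=\mathrm{Tr}(\pi^r(x))$ its character. The $G$-wavelet associated with a function $\gamma_j:\{1,\dots,k\}\to\mathbb{C}$ is $\psi_{\gamma_j}(x)=\sum_{r=1}^k d_r\,\gamma_j(r)\,\chi^r(x)$, $x\in G$. *)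

theory Defs
  imports "HOL-Algebra.Group" "Jordan_Normal_Form.Schur_Decomposition"
begin

section \<open>Matrix representations\<close>

text \<open>Representations are taken in matrix form: a representation of degree n is a function from
  the group to complex n-by-n matrices, of which only the values on the carrier matter. Every
  finite-dimensional unitary representation has this form after a choice of orthonormal basis.\<close>

definition unitary_mat :: "complex mat \<Rightarrow> bool" where
  "unitary_mat U \<longleftrightarrow>
     square_mat U \<and> inverts_mat U (mat_adjoint U) \<and> inverts_mat (mat_adjoint U) U"

text \<open>Preservation of the identity follows from multiplicativity and invertibility.\<close>

definition unitary_rep ::
    "('g, 'b) monoid_scheme \<Rightarrow> nat \<Rightarrow> ('g \<Rightarrow> complex mat) \<Rightarrow> bool" where
  "unitary_rep G n \<rho> \<longleftrightarrow>
     (\<forall>x\<in>carrier G. \<rho> x \<in> carrier_mat n n \<and> unitary_mat (\<rho> x)) \<and>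
     (\<forall>x\<in>carrier G. \<forall>y\<in>carrier G. \<rho> (x \<otimes>\<^bsub>G\<^esub> y) = \<rho> x * \<rho> y)"

definition invariant_subspace ::
    "('g, 'b) monoid_scheme \<Rightarrow> nat \<Rightarrow> ('g \<Rightarrow> complex mat) \<Rightarrow> complex vec set \<Rightarrow> bool" where
  "invariant_subspace G n \<rho> W \<longleftrightarrow>
     VectorSpace.subspace class_ring W (module_vec TYPE(complex) n) \<and>
     (\<forall>x\<in>carrier G. \<forall>w\<in>W. \<rho> x *\<^sub>v w \<in> W)"

text \<open>The zero-dimensional representation is not irreducible.\<close>

definition irreducible_unitary_rep ::
    "('g, 'b) monoid_scheme \<Rightarrow> nat \<Rightarrow> ('g \<Rightarrow> complex mat) \<Rightarrow> bool" where
  "irreducible_unitary_rep G n \<rho> \<longleftrightarrow>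
     unitary_rep G n \<rho> \<and> 0 < n \<and>
     (\<forall>W. invariant_subspace G n \<rho> W \<longrightarrow> W = {0\<^sub>v n} \<or> W = carrier_vec n)"

text \<open>An invertible matrix is in particular square, so equivalent representations have the
  same degree.\<close>

definition equivalent_reps ::
    "('g, 'b) monoid_scheme \<Rightarrow> nat \<Rightarrow> ('g \<Rightarrow> complex mat) \<Rightarrow> nat \<Rightarrow> ('g \<Rightarrow> complex mat) \<Rightarrow> bool" where
  "equivalent_reps G m \<rho> n \<sigma> \<longleftrightarrow>
     (\<exists>T. T \<in> carrier_mat n m \<and> invertible_mat T \<and> (\<forall>x\<in>carrier G. T * \<rho> x = \<sigma> x * T))"

definition complete_irrep_system ::
    "('g, 'b) monoid_scheme \<Rightarrow> nat \<Rightarrow> (nat \<Rightarrow> nat) \<Rightarrow> (nat \<Rightarrow> 'g \<Rightarrow> complex mat) \<Rightarrow> bool" where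
  "complete_irrep_system G k d \<pi> \<longleftrightarrow>
     (\<forall>r\<in>{1..k}. irreducible_unitary_rep G (d r) (\<pi> r)) \<and>
     (\<forall>r\<in>{1..k}. \<forall>s\<in>{1..k}. r \<noteq> s \<longrightarrow> \<not> equivalent_reps G (d r) (\<pi> r) (d s) (\<pi> s)) \<and>
     (\<forall>n \<rho>. irreducible_unitary_rep G n \<rho> \<longrightarrow>
        (\<exists>r\<in>{1..k}. equivalent_reps G n \<rho> (d r) (\<pi> r)))"

definition rep_character :: "('g \<Rightarrow> complex mat) \<Rightarrow> 'g \<Rightarrow> complex" where
  "rep_character \<rho> x = (\<Sum>i<dim_row (\<rho> x). \<rho> x $$ (i, i))"


section \<open>The space L2(G) and wavelets\<close>

text \<open>Functions on G are represented as functions that are undefined outside the carrier.\<close>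

definition L2_space :: "('g, 'b) monoid_scheme \<Rightarrow> ('g \<Rightarrow> complex) set" where
  "L2_space G = carrier G \<rightarrow>\<^sub>E UNIV"

definition L2_inner ::
    "('g, 'b) monoid_scheme \<Rightarrow> ('g \<Rightarrow> complex) \<Rightarrow> ('g \<Rightarrow> complex) \<Rightarrow> complex" where
  "L2_inner G f g = 1 / of_nat (card (carrier G)) * (\<Sum>x\<in>carrier G. f x * cnj (g x))"

definition L2_norm :: "('g, 'b) monoid_scheme \<Rightarrow> ('g \<Rightarrow> complex) \<Rightarrow> real" where
  "L2_norm G f = sqrt (Re (L2_inner G f f))"

definition left_regular ::
    "('g, 'b) monoid_scheme \<Rightarrow> 'g \<Rightarrow> ('g \<Rightarrow> complex) \<Rightarrow> 'g \<Rightarrow> complex" where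
  "left_regular G h f = (\<lambda>x\<in>carrier G. f (inv\<^bsub>G\<^esub> h \<otimes>\<^bsub>G\<^esub> x))"

definition G_wavelet ::
    "('g, 'b) monoid_scheme \<Rightarrow> nat \<Rightarrow> (nat \<Rightarrow> nat) \<Rightarrow> (nat \<Rightarrow> 'g \<Rightarrow> complex mat) \<Rightarrow>
     (nat \<Rightarrow> complex) \<Rightarrow> 'g \<Rightarrow> complex" where
  "G_wavelet G k d \<pi> \<gamma> =
     (\<lambda>x\<in>carrier G. \<Sum>r\<in>{1..k}. of_nat (d r) * \<gamma> r * rep_character (\<pi> r) x)"

end

theory Submission
  imports Defs "Jordan_Normal_Form.Spectral_Radius"
begin

text \<open>
  The matrix coefficients of a complete system of irreducible representations form an orthogonal
  basis of \<open>L\<^sup>2(G)\<close>. Write \<open>f = \<Sum>\<^sub>r f\<^sub>r\<close> with \<open>f\<^sub>r\<close> a combination of coefficients of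
  \<open>\<pi>\<^sup>r\<close>. Pairing \<open>f\<close> with the left translate by \<open>h\<close> of \<open>d\<^sub>r \<chi>\<^sup>r\<close> gives \<open>f\<^sub>r(h)\<close>, so
  \<open>\<langle>f, L(h)\<psi>\<^sub>j\<rangle> = \<Sum>\<^sub>r cnj (\<gamma>\<^sub>j(r)) f\<^sub>r(h)\<close> (lemma \<open>wavelet_transform\<close>). By orthogonality of the
  \<open>f\<^sub>r\<close> (lemma \<open>parseval\<close>), the middle term of the frame inequality is
  \<open>\<Sum>\<^sub>r C(r) \<parallel>f\<^sub>r\<parallel>\<^sup>2\<close>, while \<open>\<parallel>f\<parallel>\<^sup>2 = \<Sum>\<^sub>r \<parallel>f\<^sub>r\<parallel>\<^sup>2\<close>. Bounds on the \<open>C(r)\<close> therefore give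
  the frame bounds, and conversely a nonzero function with a single component \<open>f\<^sub>r\<close> shows that
  the bounds on \<open>C(r)\<close> are necessary.

  Two facts of representation theory carry this. Schur orthogonality follows from Schur's lemma
  by averaging elementary matrices over the group (\<open>averaged_intertwiner\<close>). Completeness
  (\<open>coefficients_complete\<close>) holds because every unitary representation splits along invariant
  subspaces into irreducible ones, so all its coefficients are combinations of those of the
  system; the coefficients of the right regular representation include all delta functions.
\<close>


section \<open>Adjoints and traces of complex matrices\<close>

text \<open>The conjugate transpose.\<close>

abbreviation adj :: "complex mat \<Rightarrow> complex mat" where
  "adj \<equiv> mat_adjoint"

lemma adj_dim [simp]: "dim_row (adj A) = dim_col A" "dim_col (adj A) = dim_row A"
  by (simp_all add: mat_adjoint_def)

lemma adj_index [simp]: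
  "i < dim_col A \<Longrightarrow> j < dim_row A \<Longrightarrow> adj A $$ (i, j) = cnj (A $$ (j, i))"
  by (simp add: mat_adjoint_def mat_of_rows_index)

lemma adj_carrier [simp]: "A \<in> carrier_mat n m \<Longrightarrow> adj A \<in> carrier_mat m n"
  by (rule carrier_matI) simp_all

lemma adj_adj [simp]: "adj (adj A) = A"
  by (rule eq_matI) auto

lemma mat_mult_index:
  assumes "i < dim_row A" "j < dim_col B" "dim_col A = dim_row B"
  shows "(A * B) $$ (i, j) = (\<Sum>l<dim_row B. A $$ (i, l) * (B $$ (l, j) :: complex))"
proof -
  have "(A * B) $$ (i, j) = row A i \<bullet> col B j" using assms by simp
  also have "\<dots> = (\<Sum>l<dim_row B. row A i $ l * col B j $ l)"
    by (simp add: scalar_prod_def atLeast0LessThan)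
  also have "\<dots> = (\<Sum>l<dim_row B. A $$ (i, l) * B $$ (l, j))"
    using assms by (intro sum.cong) auto
  finally show ?thesis .
qed

lemma adj_mult:
  assumes "dim_col A = dim_row B"
  shows "adj (A * B) = adj B * adj A"
  by (rule eq_matI)
    (use assms in \<open>simp_all add: mat_mult_index mult.commute del: index_mult_mat(1)\<close>)

lemma mat_mult_assoc:
  "dim_col A = dim_row B \<Longrightarrow> dim_col B = dim_row C \<Longrightarrow> A * B * C = A * (B * (C :: complex mat))"
  by (rule assoc_mult_mat[of _ "dim_row A" "dim_row B" _ "dim_col B" _ "dim_col C"]; rule carrier_matI; simp)

text \<open>The trace, summed over the row index; only used for square matrices.\<close>

definition mat_trace :: "complex mat \<Rightarrow> complex" where
  "mat_trace A = (\<Sum>i<dim_row A. A $$ (i, i))"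

lemma mat_trace_mult_commute:
  assumes "A \<in> carrier_mat n m" "B \<in> carrier_mat m n"
  shows "mat_trace (A * B) = mat_trace (B * A)"
proof -
  have "mat_trace (A * B) = (\<Sum>i<n. \<Sum>j<m. A $$ (i, j) * B $$ (j, i))"
    using assms by (auto simp: mat_trace_def mat_mult_index intro!: sum.cong simp del: index_mult_mat(1))
  also have "\<dots> = (\<Sum>j<m. \<Sum>i<n. B $$ (j, i) * A $$ (i, j))"
    by (subst sum.swap) (simp add: mult.commute)
  also have "\<dots> = mat_trace (B * A)"
    using assms by (auto simp: mat_trace_def mat_mult_index intro!: sum.cong simp del: index_mult_mat(1))
  finally show ?thesis .
qed

lemma mat_trace_one [simp]: "mat_trace (1\<^sub>m n) = of_nat n"
  by (simp add: mat_trace_def)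

text \<open>The columns of \<open>U\<close> are orthonormal. The \<open>n\<close> diagonal entries of the projection
  \<open>U * adj U\<close> are at most 1, and they sum to \<open>m\<close> by invariance of the trace.\<close>

lemma isometry_dim_le:
  assumes U: "U \<in> carrier_mat n m" and iso: "adj U * U = 1\<^sub>m m"
  shows "m \<le> n"
proof -
  define P where "P = U * adj U"
  define p where "p k = (\<Sum>j<m. (cmod (U $$ (k, j)))\<^sup>2)" for k
  have P: "P \<in> carrier_mat n n" using U by (auto simp: P_def)
  have Pkk: "P $$ (k, k) = of_real (p k)" if "k < n" for k
    using U that by (auto simp: P_def p_def mat_mult_index complex_norm_square
        simp del: index_mult_mat(1) of_real_power intro!: sum.cong)
  have PP: "P * P = P"
  proof -
    have "P * P = U * ((adj U * U) * adj U)"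
      using U by (auto simp: P_def mat_mult_assoc)
    then show ?thesis using U by (simp add: iso P_def)
  qed
  have Padj: "adj P = P" using U by (auto simp: P_def adj_mult)
  have "p k \<le> 1" if k: "k < n" for k
  proof -
    have "P $$ (k, k) = (P * P) $$ (k, k)" by (simp add: PP)
    also have "\<dots> = (\<Sum>l<n. P $$ (k, l) * P $$ (l, k))"
      using P k by (subst mat_mult_index) auto
    also have "\<dots> = (\<Sum>l<n. of_real ((cmod (P $$ (k, l)))\<^sup>2))"
    proof (rule sum.cong[OF refl])
      fix l assume "l \<in> {..<n}"
      then have "P $$ (l, k) = cnj (P $$ (k, l))"
        using adj_index[of l P k] P k Padj by auto
      then show "P $$ (k, l) * P $$ (l, k) = of_real ((cmod (P $$ (k, l)))\<^sup>2)"
        by (simp only: complex_norm_square)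
    qed
    also have "\<dots> = of_real (\<Sum>l<n. (cmod (P $$ (k, l)))\<^sup>2)" by simp
    finally have "p k = (\<Sum>l<n. (cmod (P $$ (k, l)))\<^sup>2)"
      using Pkk[OF k] by (metis of_real_eq_iff)
    also have "\<dots> \<ge> (cmod (P $$ (k, k)))\<^sup>2"
      using k by (intro member_le_sum) auto
    finally have "(cmod (P $$ (k, k)))\<^sup>2 \<le> p k" .
    then have le: "p k * p k \<le> p k"
      by (simp add: Pkk[OF k] power2_eq_square)
    show ?thesis
    proof (rule ccontr)
      assume "\<not> p k \<le> 1"
      then have "p k * 1 < p k * p k" by (intro mult_strict_left_mono) auto
      with le show False by simp
    qed
  qed
  then have "(\<Sum>k<n. p k) \<le> real n"
    using sum_mono[of "{..<n}" p "\<lambda>_. 1"] by simp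
  moreover have "complex_of_real (\<Sum>k<n. p k) = of_nat m"
  proof -
    have "complex_of_real (\<Sum>k<n. p k) = mat_trace P"
      using P Pkk by (simp add: mat_trace_def)
    also have "\<dots> = mat_trace (adj U * U)"
      unfolding P_def using U by (intro mat_trace_mult_commute) auto
    finally show ?thesis by (simp add: iso)
  qed
  then have "(\<Sum>k<n. p k) = real m" by (metis of_real_eq_iff of_real_of_nat_eq)
  ultimately show ?thesis by simp
qed


section \<open>Subspaces of complex coordinate space\<close>

lemma subspace_iff:
  "VectorSpace.subspace class_ring W (module_vec TYPE(complex) n) \<longleftrightarrow>
     W \<subseteq> carrier_vec n \<and> 0\<^sub>v n \<in> W \<and> (\<forall>v\<in>W. \<forall>w\<in>W. v + w \<in> W) \<and> (\<forall>a. \<forall>v\<in>W. a \<cdot>\<^sub>v v \<in> W)"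
    (is "?L \<longleftrightarrow> ?R")
proof -
  interpret vec_space "TYPE(complex)" n .
  have vs: "vectorspace class_ring (module_vec TYPE(complex) n)" by unfold_locales
  have "?L \<longleftrightarrow> submodule class_ring W V"
    by (simp add: VectorSpace.subspace_def vs)
  also have "\<dots> \<longleftrightarrow> ?R"
    unfolding submodule_def using module_axioms
    by (auto simp: module_vec_simps class_ring_simps)
  finally show ?thesis .
qed

text \<open>Here \<open>n = m\<close> is a consequence: a right inverse \<open>S\<close> is also a left inverse by injectivity,
  and \<open>T * S\<close> and \<open>S * T\<close> have the same trace.\<close>

lemma invertible_mat_of_inj_surj:
  fixes T :: "complex mat"
  assumes T: "T \<in> carrier_mat n m"
    and inj: "\<And>v. v \<in> carrier_vec m \<Longrightarrow> T *\<^sub>v v = 0\<^sub>v n \<Longrightarrow> v = 0\<^sub>v m"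
    and surj: "\<And>w. w \<in> carrier_vec n \<Longrightarrow> \<exists>v\<in>carrier_vec m. T *\<^sub>v v = w"
  shows "invertible_mat T"
proof -
  have "\<forall>i. \<exists>v. i < n \<longrightarrow> v \<in> carrier_vec m \<and> T *\<^sub>v v = unit_vec n i"
    using surj by (meson unit_vec_carrier)
  then obtain s where s: "\<And>i. i < n \<Longrightarrow> s i \<in> carrier_vec m \<and> T *\<^sub>v s i = unit_vec n i"
    by metis
  define S where "S = mat m n (\<lambda>(i, j). s j $ i)"
  have S: "S \<in> carrier_mat m n" by (simp add: S_def)
  have colS: "col S j = s j" if "j < n" for j
    using that s[OF that] by (auto simp: S_def intro!: eq_vecI)
  have TS: "T * S = 1\<^sub>m n"
  proof (rule mat_col_eqI)
    fix j assume "j < dim_col (1\<^sub>m n :: complex mat)"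
    then have j: "j < n" by simp
    have "col (T * S) j = unit_vec n j"
      unfolding col_mult2[OF T S j] colS[OF j] using s[OF j] by blast
    then show "col (T * S) j = col (1\<^sub>m n) j" by (simp only: col_one[OF j])
  qed (use T S in auto)
  have ST: "S * T = 1\<^sub>m m"
  proof (rule mat_col_eqI)
    fix j assume "j < dim_col (1\<^sub>m m :: complex mat)"
    then have j: "j < m" by simp
    define v where "v = col (S * T) j - unit_vec m j"
    have v: "v \<in> carrier_vec m" using S T j by (simp add: v_def)
    have "T *\<^sub>v col (S * T) j = col (T * (S * T)) j"
      using T S j by (simp add: col_mult2[of _ n m _ m])
    also have "T * (S * T) = T" using T S TS by (simp flip: assoc_mult_mat[OF T S T])
    also have "col T j = T *\<^sub>v unit_vec m j"
      using T j col_mult2[OF T one_carrier_mat[of m] j] by simp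
    finally have "T *\<^sub>v v = 0\<^sub>v n"
      using T S j by (simp add: v_def mult_minus_distrib_mat_vec[of _ n m])
    with v inj have "v = 0\<^sub>v m" by blast
    then have "col (S * T) j = unit_vec m j"
      using S T j unfolding v_def by (intro eq_vecI) (auto simp: vec_eq_iff)
    then show "col (S * T) j = col (1\<^sub>m m) j" using j by simp
  qed (use T S in auto)
  have "(of_nat n :: complex) = of_nat m"
    using mat_trace_mult_commute[OF T S] by (simp add: TS ST)
  then have "n = m" by simp
  then show ?thesis using T S TS ST
    by (auto simp: invertible_mat_def inverts_mat_def)
qed

text \<open>A subspace of \<open>\<complex>\<^sup>n\<close> has an orthonormal basis, collected in the columns of \<open>U\<close>; then
  \<open>U * adj U\<close> is the orthogonal projection onto the subspace.\<close>

lemma subspace_orthonormal_basis: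
  assumes sub: "VectorSpace.subspace class_ring W (module_vec TYPE(complex) n)"
  obtains m U where "U \<in> carrier_mat n m" "adj U * U = 1\<^sub>m m"
    "\<And>v. v \<in> W \<Longrightarrow> U *\<^sub>v (adj U *\<^sub>v v) = v"
    "\<And>c. c \<in> carrier_vec m \<Longrightarrow> U *\<^sub>v c \<in> W"
proof -
  have WC: "W \<subseteq> carrier_vec n" and W0: "0\<^sub>v n \<in> W"
    and Wadd: "\<And>v w. v \<in> W \<Longrightarrow> w \<in> W \<Longrightarrow> v + w \<in> W"
    and Wsm: "\<And>a v. v \<in> W \<Longrightarrow> a \<cdot>\<^sub>v v \<in> W"
    using sub unfolding subspace_iff by auto
  (* An orthonormal family in W of maximal length; m <= n bounds the length. *)
  define M where "M m u = mat n m (\<lambda>(i, j). u j $ i)" for m and u :: "nat \<Rightarrow> complex vec"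
  define ON where "ON m u \<longleftrightarrow> (\<forall>j<m. u j \<in> W) \<and> adj (M m u) * M m u = 1\<^sub>m m" for m u
  have Mc: "M m u \<in> carrier_mat n m" for m u by (simp add: M_def)
  have bound: "m \<le> n" if "ON m u" for m u
    using that isometry_dim_le[OF Mc] by (auto simp: ON_def)
  have "ON 0 u" for u by (auto simp: ON_def M_def)
  then have ex: "\<exists>m. \<exists>u. ON m u" by blast
  define m where "m = (GREATEST m. \<exists>u. ON m u)"
  have "\<exists>u. ON m u"
    unfolding m_def by (rule GreatestI_ex_nat[OF ex]) (use bound in blast)
  then obtain u where u: "ON m u" by blast
  have max: "\<not> ON (Suc m) w" for w
  proof
    assume "ON (Suc m) w"
    then have "Suc m \<le> m"
      unfolding m_def using bound by (intro Greatest_le_nat[of _ _ n]) blast+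
    then show False by simp
  qed
  define U where "U = M m u"
  have Uc: "U \<in> carrier_mat n m" by (simp add: U_def Mc)
  have iso: "adj U * U = 1\<^sub>m m" using u by (simp add: ON_def U_def)
  have comb: "l \<le> m \<Longrightarrow> vec n (\<lambda>i. \<Sum>j<l. c j * u j $ i) \<in> W" for l c
  proof (induction l)
    case 0
    show ?case using W0 by (simp add: zero_vec_def)
  next
    case (Suc l)
    have ul: "u l \<in> W" using u Suc.prems by (auto simp: ON_def)
    have "vec n (\<lambda>i. \<Sum>j<Suc l. c j * u j $ i) = vec n (\<lambda>i. \<Sum>j<l. c j * u j $ i) + c l \<cdot>\<^sub>v u l"
      using ul WC by (intro eq_vecI) auto
    moreover have "\<dots> \<in> W"
      using Suc.IH Suc.prems Wsm[OF ul] by (intro Wadd) auto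
    ultimately show ?case by (rule ssubst)
  qed
  have inW: "U *\<^sub>v c \<in> W" if "c \<in> carrier_vec m" for c
  proof -
    have "U *\<^sub>v c = vec n (\<lambda>i. \<Sum>j<m. c $ j * u j $ i)"
      using that by (auto simp: U_def M_def scalar_prod_def atLeast0LessThan mult.commute
          intro!: eq_vecI sum.cong)
    then show ?thesis using comb[of m] by simp
  qed
  have fixW: "U *\<^sub>v (adj U *\<^sub>v v) = v" if v: "v \<in> W" for v
  proof (rule ccontr)
    assume ne: "U *\<^sub>v (adj U *\<^sub>v v) \<noteq> v"
    have vc: "v \<in> carrier_vec n" using v WC by auto
    have ac: "adj U *\<^sub>v v \<in> carrier_vec m"
      by (rule mult_mat_vec_carrier[OF adj_carrier[OF Uc] vc])
    (* The normalised residual of v would extend the maximal family. *)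
    define z where "z = v + (-1) \<cdot>\<^sub>v (U *\<^sub>v (adj U *\<^sub>v v))"
    have zW: "z \<in> W" unfolding z_def by (intro Wadd Wsm v inW[OF ac])
    then have zc: "z \<in> carrier_vec n" using WC by auto
    have orth: "adj U *\<^sub>v z = 0\<^sub>v m"
    proof -
      have Uac: "U *\<^sub>v (adj U *\<^sub>v v) \<in> carrier_vec n"
        by (rule mult_mat_vec_carrier[OF Uc ac])
      have "adj U *\<^sub>v z = adj U *\<^sub>v v + (-1) \<cdot>\<^sub>v (adj U *\<^sub>v (U *\<^sub>v (adj U *\<^sub>v v)))"
        unfolding z_def using Uc vc Uac
        by (simp add: mult_add_distrib_mat_vec[of _ m n] mult_mat_vec[of _ m n])
      also have "adj U *\<^sub>v (U *\<^sub>v (adj U *\<^sub>v v)) = (adj U * U) *\<^sub>v (adj U *\<^sub>v v)"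
        using Uc ac by (simp add: assoc_mult_mat_vec[of _ m n _ m])
      also have "\<dots> = adj U *\<^sub>v v" using ac by (simp add: iso)
      also have "x + (-1) \<cdot>\<^sub>v x = 0\<^sub>v m" if "x \<in> carrier_vec m" for x :: "complex vec"
        using that by (intro eq_vecI) auto
      note this[OF ac]
      finally show ?thesis .
    qed
    define s where "s = (\<Sum>k<n. (cmod (z $ k))\<^sup>2)"
    have s0: "s > 0"
    proof -
      have "z \<noteq> 0\<^sub>v n"
      proof
        assume z0: "z = 0\<^sub>v n"
        have "(U *\<^sub>v (adj U *\<^sub>v v)) = v"
        proof (rule eq_vecI)
          fix i assume "i < dim_vec v"
          then have i: "i < n" using vc by simp
          have "z $ i = 0" using z0 i by simp
          moreover have "z $ i = v $ i - (U *\<^sub>v (adj U *\<^sub>v v)) $ i"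
            unfolding z_def using i vc Uc by simp
          ultimately show "(U *\<^sub>v (adj U *\<^sub>v v)) $ i = v $ i" by simp
        qed (use Uc vc in auto)
        with ne show False by simp
      qed
      then obtain k where "k < n" "z $ k \<noteq> 0" using zc by (auto simp: vec_eq_iff)
      then show ?thesis unfolding s_def by (intro sum_pos2[of _ k]) auto
    qed
    define w where "w = complex_of_real (1 / sqrt s) \<cdot>\<^sub>v z"
    have wW: "w \<in> W" using zW Wsm by (simp add: w_def)
    have wc: "w \<in> carrier_vec n" using zc by (simp add: w_def)
    have orthw: "(\<Sum>k<n. cnj (u i $ k) * w $ k) = 0" if i: "i < m" for i
    proof -
      have "(\<Sum>k<n. cnj (u i $ k) * z $ k) = (adj U *\<^sub>v z) $ i"
        using i Uc zc by (auto simp: scalar_prod_def U_def M_def atLeast0LessThan intro!: sum.cong)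
      also have "\<dots> = 0" using orth i by simp
      finally show ?thesis using zc unfolding w_def
        by (simp add: mult.left_commute flip: sum_distrib_left sum_divide_distrib)
    qed
    have normw: "(\<Sum>k<n. cnj (w $ k) * w $ k) = 1"
    proof -
      have "(\<Sum>k<n. cnj (w $ k) * w $ k) = (\<Sum>k<n. of_real ((cmod (w $ k))\<^sup>2))"
        by (intro sum.cong refl) (simp only: complex_norm_square mult.commute)
      also have "\<dots> = of_real (\<Sum>k<n. (cmod (z $ k))\<^sup>2 / s)"
        using zc s0 by (auto simp: w_def norm_mult norm_divide power_divide intro!: sum.cong)
      also have "\<dots> = 1" using s0 unfolding sum_divide_distrib[symmetric] s_def by simp
      finally show ?thesis .
    qed
    have "ON (Suc m) (u(m := w))"
      unfolding ON_def
    proof (intro conjI allI impI eq_matI)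
      fix j assume "j < Suc m"
      then show "(u(m := w)) j \<in> W" using u wW by (auto simp: ON_def less_Suc_eq)
    next
      fix i j assume "i < dim_row (1\<^sub>m (Suc m) :: complex mat)" "j < dim_col (1\<^sub>m (Suc m) :: complex mat)"
      then have ij: "i < Suc m" "j < Suc m" by auto
      let ?u = "u(m := w)"
      have E: "(adj (M (Suc m) ?u) * M (Suc m) ?u) $$ (i, j) = (\<Sum>k<n. cnj (?u i $ k) * ?u j $ k)"
        using ij by (subst mat_mult_index) (auto simp: M_def intro!: sum.cong)
      have old: "(\<Sum>k<n. cnj (u i $ k) * u j $ k) = (if i = j then 1 else 0)" if "i < m" "j < m"
      proof -
        have "(adj U * U) $$ (i, j) = (\<Sum>k<n. cnj (u i $ k) * u j $ k)"
          using that by (subst mat_mult_index) (auto simp: U_def M_def intro!: sum.cong)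
        then show ?thesis using that by (simp add: iso)
      qed
      have sym: "(\<Sum>k<n. cnj (w $ k) * u j $ k) = 0" if "j < m"
        using arg_cong[OF orthw[OF that], of cnj] by (simp add: mult.commute)
      show "(adj (M (Suc m) ?u) * M (Suc m) ?u) $$ (i, j) = 1\<^sub>m (Suc m) $$ (i, j)"
        unfolding E using ij old sym orthw normw by (auto simp: less_Suc_eq)
    qed (auto simp: M_def)
    with max show False by blast
  qed
  show ?thesis by (rule that[OF Uc iso fixW inW])
qed

text \<open>The same orthonormal basis in projection form; for a proper subspace it has fewer than
  \<open>n\<close> members.\<close>

lemma subspace_isometry:
  assumes sub: "VectorSpace.subspace class_ring W (module_vec TYPE(complex) n)"
  obtains U m where "U \<in> carrier_mat n m" "adj U * U = 1\<^sub>m m" "W \<noteq> carrier_vec n \<Longrightarrow> m < n"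
    "\<And>v. v \<in> W \<Longrightarrow> (U * adj U) *\<^sub>v v = v" "\<And>j. j < m \<Longrightarrow> col U j \<in> W"
    "\<And>B p. B \<in> carrier_mat n p \<Longrightarrow> (\<And>j. j < p \<Longrightarrow> col B j \<in> W) \<Longrightarrow> (U * adj U) * B = B"
proof -
  obtain m U where U: "U \<in> carrier_mat n m" and iso: "adj U * U = 1\<^sub>m m"
    and fixW: "\<And>v. v \<in> W \<Longrightarrow> U *\<^sub>v (adj U *\<^sub>v v) = v"
    and inW: "\<And>c. c \<in> carrier_vec m \<Longrightarrow> U *\<^sub>v c \<in> W"
    using subspace_orthonormal_basis[OF sub] by metis
  have U': "adj U \<in> carrier_mat m n" using U by simp
  have P: "U * adj U \<in> carrier_mat n n" using U U' by (rule mult_carrier_mat)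
  have WC: "W \<subseteq> carrier_vec n" using sub unfolding subspace_iff by blast
  have less: "m < n" if "W \<noteq> carrier_vec n"
  proof (rule ccontr)
    assume "\<not> m < n"
    with isometry_dim_le[OF U iso] have mn: "m = n" by simp
    have one: "U * adj U = 1\<^sub>m n"
      using mat_mult_left_right_inverse[of "adj U" n U] U U' iso unfolding mn by blast
    have "v \<in> W" if v: "v \<in> carrier_vec n" for v
    proof -
      have "v = U *\<^sub>v (adj U *\<^sub>v v)"
        using assoc_mult_mat_vec[OF U U' v] v by (simp add: one)
      moreover have "U *\<^sub>v (adj U *\<^sub>v v) \<in> W" by (rule inW[OF mult_mat_vec_carrier[OF U' v]])
      ultimately show ?thesis by simp
    qed
    with WC \<open>W \<noteq> carrier_vec n\<close> show False by blast
  qed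
  have fix': "(U * adj U) *\<^sub>v v = v" if v: "v \<in> W" for v
    using assoc_mult_mat_vec[OF U U', of v] fixW[OF v] v WC by auto
  have cols: "col U j \<in> W" if j: "j < m" for j
  proof -
    have "col U j = U *\<^sub>v unit_vec m j"
      using U j col_mult2[OF U one_carrier_mat[of m] j] by simp
    then show ?thesis using inW by simp
  qed
  have fixB: "(U * adj U) * B = B"
    if B: "B \<in> carrier_mat n p" and colB: "\<And>j. j < p \<Longrightarrow> col B j \<in> W" for B p
  proof (rule mat_col_eqI)
    fix j assume "j < dim_col B"
    then have j: "j < p" using B by simp
    show "col (U * adj U * B) j = col B j"
      unfolding col_mult2[OF P B j] by (rule fix'[OF colB[OF j]])
  qed (use P B in auto)
  show ?thesis by (rule that[OF U iso less fix' cols fixB])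
qed


section \<open>Unitary representations and Schur's lemma\<close>

context group
begin

lemma unitary_repD:
  assumes "unitary_rep G n \<rho>" "x \<in> carrier G"
  shows "\<rho> x \<in> carrier_mat n n" "\<rho> x * adj (\<rho> x) = 1\<^sub>m n" "adj (\<rho> x) * \<rho> x = 1\<^sub>m n"
  using assms by (auto simp: unitary_rep_def unitary_mat_def inverts_mat_def)

lemma unitary_rep_mult:
  assumes "unitary_rep G n \<rho>" "x \<in> carrier G" "y \<in> carrier G"
  shows "\<rho> (x \<otimes> y) = \<rho> x * \<rho> y"
  using assms by (auto simp: unitary_rep_def)

lemma unitary_repI:
  assumes c: "\<And>x. x \<in> carrier G \<Longrightarrow> \<rho> x \<in> carrier_mat n n"
    and u: "\<And>x. x \<in> carrier G \<Longrightarrow> \<rho> x * adj (\<rho> x) = 1\<^sub>m n"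
    and m: "\<And>x y. x \<in> carrier G \<Longrightarrow> y \<in> carrier G \<Longrightarrow> \<rho> (x \<otimes> y) = \<rho> x * \<rho> y"
  shows "unitary_rep G n \<rho>"
proof -
  have "adj (\<rho> x) * \<rho> x = 1\<^sub>m n" if "x \<in> carrier G" for x
    using mat_mult_left_right_inverse[OF c adj_carrier[OF c] u] that by blast
  then show ?thesis
    using c u m by (fastforce simp: unitary_rep_def unitary_mat_def inverts_mat_def)
qed

lemma unitary_rep_one:
  assumes \<rho>: "unitary_rep G n \<rho>"
  shows "\<rho> \<one> = 1\<^sub>m n"
proof -
  note c = unitary_repD[OF \<rho> one_closed]
  have "\<rho> \<one> * \<rho> \<one> = \<rho> \<one>" using unitary_rep_mult[OF \<rho> one_closed one_closed] by simp
  then have "adj (\<rho> \<one>) * (\<rho> \<one> * \<rho> \<one>) = 1\<^sub>m n" by (simp add: c)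
  moreover have "adj (\<rho> \<one>) * (\<rho> \<one> * \<rho> \<one>) = (adj (\<rho> \<one>) * \<rho> \<one>) * \<rho> \<one>"
    using c(1) by (simp add: mat_mult_assoc)
  ultimately show ?thesis using c by simp
qed

lemma unitary_rep_inv:
  assumes \<rho>: "unitary_rep G n \<rho>" and x: "x \<in> carrier G"
  shows "\<rho> (inv x) = adj (\<rho> x)"
proof -
  note c = unitary_repD[OF \<rho> x] and c' = unitary_repD[OF \<rho> inv_closed[OF x]]
  have "\<rho> x * \<rho> (inv x) = 1\<^sub>m n"
    using unitary_rep_mult[OF \<rho> x inv_closed[OF x]] x by (simp add: unitary_rep_one[OF \<rho>])
  then have "adj (\<rho> x) * (\<rho> x * \<rho> (inv x)) = adj (\<rho> x)"
    using right_mult_one_mat[OF adj_carrier[OF c(1)]] by simp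
  moreover have "adj (\<rho> x) * (\<rho> x * \<rho> (inv x)) = \<rho> (inv x)"
    using c(1) c'(1) assoc_mult_mat[OF adj_carrier[OF c(1)] c(1) c'(1)] by (simp add: c(3))
  ultimately show ?thesis by simp
qed

lemma irreducibleD:
  assumes "irreducible_unitary_rep G n \<rho>"
  shows "unitary_rep G n \<rho>" "0 < n"
    "\<And>W. invariant_subspace G n \<rho> W \<Longrightarrow> W = {0\<^sub>v n} \<or> W = carrier_vec n"
  using assms by (auto simp: irreducible_unitary_rep_def)

text \<open>The kernel of an intertwiner is invariant, and so is its range.\<close>

lemma intertwiner_injective:
  assumes irr: "irreducible_unitary_rep G m \<rho>" and \<sigma>: "unitary_rep G n \<sigma>"
    and T: "T \<in> carrier_mat n m" and nz: "T \<noteq> 0\<^sub>m n m"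
    and comm: "\<And>x. x \<in> carrier G \<Longrightarrow> T * \<rho> x = \<sigma> x * T"
    and v: "v \<in> carrier_vec m" "T *\<^sub>v v = 0\<^sub>v n"
  shows "v = 0\<^sub>v m"
proof -
  define W where "W = {v \<in> carrier_vec m. T *\<^sub>v v = 0\<^sub>v n}"
  note \<rho> = irreducibleD(1)[OF irr]
  have "invariant_subspace G m \<rho> W"
    unfolding invariant_subspace_def subspace_iff
  proof (intro conjI ballI allI)
    fix x w assume x: "x \<in> carrier G" and w: "w \<in> W"
    note rx = unitary_repD(1)[OF \<rho> x] and sx = unitary_repD(1)[OF \<sigma> x]
    have wc: "w \<in> carrier_vec m" and w0: "T *\<^sub>v w = 0\<^sub>v n" using w by (auto simp: W_def)
    have "T *\<^sub>v (\<rho> x *\<^sub>v w) = (T * \<rho> x) *\<^sub>v w"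
      by (rule assoc_mult_mat_vec[OF T rx wc, symmetric])
    also have "\<dots> = \<sigma> x *\<^sub>v (T *\<^sub>v w)"
      unfolding comm[OF x] by (rule assoc_mult_mat_vec[OF sx T wc])
    also have "\<dots> = 0\<^sub>v n" unfolding w0 using sx by (intro eq_vecI) auto
    finally show "\<rho> x *\<^sub>v w \<in> W"
      unfolding W_def using mult_mat_vec_carrier[OF rx wc] by simp
  next
    show "0\<^sub>v m \<in> W" using T unfolding W_def by (auto intro!: eq_vecI)
  next
    fix w w' assume "w \<in> W" "w' \<in> W"
    then show "w + w' \<in> W"
      using T by (simp add: W_def mult_add_distrib_mat_vec[OF T])
  next
    fix a w assume "w \<in> W"
    then show "a \<cdot>\<^sub>v w \<in> W"
      using T by (auto simp: W_def mult_mat_vec[OF T] intro!: eq_vecI)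
  qed (auto simp: W_def)
  then consider "W = {0\<^sub>v m}" | "W = carrier_vec m" using irreducibleD(3)[OF irr] by blast
  then show ?thesis
  proof cases
    case 1
    then show ?thesis using v by (auto simp: W_def)
  next
    case 2
    have "T = 0\<^sub>m n m"
    proof (rule mat_col_eqI)
      fix j assume "j < dim_col (0\<^sub>m n m :: complex mat)"
      then have j: "j < m" by simp
      have "col T j = T *\<^sub>v unit_vec m j"
        using T j col_mult2[OF T one_carrier_mat[of m] j] by simp
      also have "unit_vec m j \<in> W" using 2 by simp
      then have "T *\<^sub>v unit_vec m j = 0\<^sub>v n" by (simp add: W_def)
      finally show "col T j = col (0\<^sub>m n m) j" using j by simp
    qed (use T in auto)
    with nz show ?thesis by simp
  qed
qed

lemma intertwiner_surjective:
  assumes irr: "irreducible_unitary_rep G n \<sigma>" and \<rho>: "unitary_rep G m \<rho>"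
    and T: "T \<in> carrier_mat n m" and nz: "T \<noteq> 0\<^sub>m n m"
    and comm: "\<And>x. x \<in> carrier G \<Longrightarrow> T * \<rho> x = \<sigma> x * T"
    and w: "w \<in> carrier_vec n"
  shows "\<exists>v\<in>carrier_vec m. T *\<^sub>v v = w"
proof -
  define W where "W = {T *\<^sub>v v |v. v \<in> carrier_vec m}"
  note \<sigma> = irreducibleD(1)[OF irr]
  have "invariant_subspace G n \<sigma> W"
    unfolding invariant_subspace_def subspace_iff
  proof (intro conjI ballI allI)
    fix x w assume x: "x \<in> carrier G" and w: "w \<in> W"
    note rx = unitary_repD(1)[OF \<rho> x] and sx = unitary_repD(1)[OF \<sigma> x]
    obtain v where vc: "v \<in> carrier_vec m" and wv: "w = T *\<^sub>v v" using w by (auto simp: W_def)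
    have "\<sigma> x *\<^sub>v w = (T * \<rho> x) *\<^sub>v v"
      unfolding wv comm[OF x] by (rule assoc_mult_mat_vec[OF sx T vc, symmetric])
    also have "\<dots> = T *\<^sub>v (\<rho> x *\<^sub>v v)" by (rule assoc_mult_mat_vec[OF T rx vc])
    finally show "\<sigma> x *\<^sub>v w \<in> W"
      unfolding W_def using mult_mat_vec_carrier[OF rx vc] by blast
  next
    have "T *\<^sub>v 0\<^sub>v m = 0\<^sub>v n" using T by (auto intro!: eq_vecI)
    then show "0\<^sub>v n \<in> W" unfolding W_def by (metis (mono_tags, lifting) mem_Collect_eq zero_carrier_vec)
  next
    fix w w' assume "w \<in> W" "w' \<in> W"
    then obtain v v' where "v \<in> carrier_vec m" "w = T *\<^sub>v v" "v' \<in> carrier_vec m" "w' = T *\<^sub>v v'"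
      by (auto simp: W_def)
    then have "v + v' \<in> carrier_vec m" "w + w' = T *\<^sub>v (v + v')"
      by (auto simp: mult_add_distrib_mat_vec[OF T])
    then show "w + w' \<in> W" unfolding W_def by blast
  next
    fix a w assume "w \<in> W"
    then obtain v where "v \<in> carrier_vec m" "w = T *\<^sub>v v"
      by (auto simp: W_def)
    then have "a \<cdot>\<^sub>v v \<in> carrier_vec m" "a \<cdot>\<^sub>v w = T *\<^sub>v (a \<cdot>\<^sub>v v)"
      by (auto simp: mult_mat_vec[OF T])
    then show "a \<cdot>\<^sub>v w \<in> W" unfolding W_def by blast
  qed (use T in \<open>auto simp: W_def\<close>)
  then consider "W = {0\<^sub>v n}" | "W = carrier_vec n" using irreducibleD(3)[OF irr] by blast
  then show ?thesis
  proof cases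
    case 1
    have "T = 0\<^sub>m n m"
    proof (rule mat_col_eqI)
      fix j assume "j < dim_col (0\<^sub>m n m :: complex mat)"
      then have j: "j < m" by simp
      have "col T j = T *\<^sub>v unit_vec m j"
        using T j col_mult2[OF T one_carrier_mat[of m] j] by simp
      also have "T *\<^sub>v unit_vec m j \<in> W" unfolding W_def by auto
      then have "T *\<^sub>v unit_vec m j = 0\<^sub>v n" using 1 by simp
      finally show "col T j = col (0\<^sub>m n m) j" using j by simp
    qed (use T in auto)
    with nz show ?thesis by simp
  next
    case 2
    then have "w \<in> W" using w by simp
    then show ?thesis by (auto simp: W_def)
  qed
qed

lemma schur_inequivalent:
  assumes "irreducible_unitary_rep G m \<rho>" "irreducible_unitary_rep G n \<sigma>"
    and "\<not> equivalent_reps G m \<rho> n \<sigma>"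
    and T: "T \<in> carrier_mat n m"
    and comm: "\<And>x. x \<in> carrier G \<Longrightarrow> T * \<rho> x = \<sigma> x * T"
  shows "T = 0\<^sub>m n m"
proof (rule ccontr)
  assume nz: "T \<noteq> 0\<^sub>m n m"
  note \<rho> = irreducibleD(1)[OF assms(1)] and \<sigma> = irreducibleD(1)[OF assms(2)]
  have "invertible_mat T"
    by (rule invertible_mat_of_inj_surj[OF T])
      (use intertwiner_injective[OF assms(1) \<sigma> T nz comm]
        intertwiner_surjective[OF assms(2) \<rho> T nz comm] in blast)+
  then show False using assms T by (auto simp: equivalent_reps_def)
qed

text \<open>Over the complex numbers an endomorphism \<open>T\<close> has an eigenvalue \<open>c\<close>, and \<open>T - c\<close> is
  an intertwiner with a nontrivial kernel.\<close>

lemma schur_scalar: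
  assumes irr: "irreducible_unitary_rep G n \<rho>"
    and T: "T \<in> carrier_mat n n"
    and comm: "\<And>x. x \<in> carrier G \<Longrightarrow> T * \<rho> x = \<rho> x * T"
  obtains c where "T = c \<cdot>\<^sub>m 1\<^sub>m n"
proof -
  note \<rho> = irreducibleD(1)[OF irr]
  obtain c where "eigenvalue T c"
    using spectrum_non_empty[OF T irreducibleD(2)[OF irr]] by (auto simp: spectrum_def)
  then obtain v where v: "v \<in> carrier_vec n" "v \<noteq> 0\<^sub>v n" "T *\<^sub>v v = c \<cdot>\<^sub>v v"
    using T by (auto simp: eigenvalue_def eigenvector_def)
  define S where "S = T - c \<cdot>\<^sub>m 1\<^sub>m n"
  have cI: "c \<cdot>\<^sub>m 1\<^sub>m n \<in> carrier_mat n n" by simp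
  have S: "S \<in> carrier_mat n n" using T by (simp add: S_def minus_carrier_mat)
  have "S *\<^sub>v v = 0\<^sub>v n"
  proof -
    have "S *\<^sub>v v = T *\<^sub>v v - (c \<cdot>\<^sub>m 1\<^sub>m n) *\<^sub>v v"
      unfolding S_def by (rule minus_mult_distrib_mat_vec[OF T cI v(1)])
    also have "(c \<cdot>\<^sub>m 1\<^sub>m n) *\<^sub>v v = c \<cdot>\<^sub>v v"
      using v(1) by (auto intro!: eq_vecI)
    finally show ?thesis using v by (auto intro!: eq_vecI)
  qed
  moreover have "S * \<rho> x = \<rho> x * S" if x: "x \<in> carrier G" for x
  proof -
    note rx = unitary_repD(1)[OF \<rho> x]
    have "S * \<rho> x = T * \<rho> x - (c \<cdot>\<^sub>m 1\<^sub>m n) * \<rho> x"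
      unfolding S_def by (rule minus_mult_distrib_mat[OF T cI rx])
    also have "(c \<cdot>\<^sub>m 1\<^sub>m n) * \<rho> x = \<rho> x * (c \<cdot>\<^sub>m 1\<^sub>m n)"
      using rx mult_smult_assoc_mat[OF one_carrier_mat rx, of c]
        mult_smult_distrib[OF rx one_carrier_mat, of c] by simp
    also have "T * \<rho> x - \<rho> x * (c \<cdot>\<^sub>m 1\<^sub>m n) = \<rho> x * S"
      unfolding S_def comm[OF x] by (rule mult_minus_distrib_mat[OF rx T cI, symmetric])
    finally show ?thesis .
  qed
  ultimately have S0: "S = 0\<^sub>m n n"
    using intertwiner_injective[OF irr \<rho> S _ _ v(1)] v(2) by blast
  have "T = c \<cdot>\<^sub>m 1\<^sub>m n"
  proof (rule eq_matI)
    fix i j assume "i < dim_row (c \<cdot>\<^sub>m 1\<^sub>m n)" "j < dim_col (c \<cdot>\<^sub>m 1\<^sub>m n)"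
    then have ij: "i < n" "j < n" by auto
    have "S $$ (i, j) = 0" using S0 ij by simp
    then show "T $$ (i, j) = (c \<cdot>\<^sub>m 1\<^sub>m n) $$ (i, j)"
      using ij T by (simp add: S_def)
  qed (use T in auto)
  then show ?thesis by (rule that)
qed

lemma sum_carrier_translate:
  assumes "y \<in> carrier G"
  shows "(\<Sum>x\<in>carrier G. f (y \<otimes> x)) = (\<Sum>x\<in>carrier G. f x)"
proof (rule sum.reindex_bij_betw)
  show "bij_betw (\<lambda>x. y \<otimes> x) (carrier G) (carrier G)"
    using assms by (intro bij_betwI[where g = "\<lambda>x. inv y \<otimes> x"]) (auto simp flip: m_assoc)
qed

text \<open>\<open>T\<close> is the group sum \<open>\<Sum>\<^sub>x \<sigma>(x) E\<^sub>j\<^sub>l adj (\<rho>(x))\<close> of an elementary matrix; its entries are the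
  unnormalised inner products of matrix coefficients.\<close>

lemma averaged_intertwiner:
  assumes \<rho>: "unitary_rep G m \<rho>" and \<sigma>: "unitary_rep G n \<sigma>"
    and j: "j < n" and l: "l < m" and y: "y \<in> carrier G"
    and T_def: "T = mat n m (\<lambda>(i, k). \<Sum>x\<in>carrier G. \<sigma> x $$ (i, j) * cnj (\<rho> x $$ (k, l)))"
  shows "T * \<rho> y = \<sigma> y * T"
proof (rule eq_matI)
  note ry = unitary_repD(1)[OF \<rho> y] and sy = unitary_repD(1)[OF \<sigma> y]
  have T: "T \<in> carrier_mat n m" by (simp add: T_def)
  fix i k assume "i < dim_row (\<sigma> y * T)" "k < dim_col (\<sigma> y * T)"
  then have i: "i < n" and k: "k < m" using sy T by auto
  have 1: "(\<sigma> y * T) $$ (i, k) = (\<Sum>x\<in>carrier G. \<sigma> (y \<otimes> x) $$ (i, j) * cnj (\<rho> x $$ (k, l)))"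
  proof -
    have "(\<sigma> y * T) $$ (i, k) = (\<Sum>a<n. \<sigma> y $$ (i, a) *
            (\<Sum>x\<in>carrier G. \<sigma> x $$ (a, j) * cnj (\<rho> x $$ (k, l))))"
      using i k sy T by (subst mat_mult_index) (auto simp: T_def intro!: sum.cong)
    also have "\<dots> = (\<Sum>x\<in>carrier G. (\<Sum>a<n. \<sigma> y $$ (i, a) * \<sigma> x $$ (a, j)) * cnj (\<rho> x $$ (k, l)))"
      unfolding sum_distrib_left sum_distrib_right by (subst sum.swap) (simp add: mult.assoc)
    also have "\<dots> = (\<Sum>x\<in>carrier G. \<sigma> (y \<otimes> x) $$ (i, j) * cnj (\<rho> x $$ (k, l)))"
    proof (rule sum.cong[OF refl])
      fix x assume x: "x \<in> carrier G"
      show "(\<Sum>a<n. \<sigma> y $$ (i, a) * \<sigma> x $$ (a, j)) * cnj (\<rho> x $$ (k, l)) =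
            \<sigma> (y \<otimes> x) $$ (i, j) * cnj (\<rho> x $$ (k, l))"
        using i j sy unitary_repD(1)[OF \<sigma> x]
        unfolding unitary_rep_mult[OF \<sigma> y x] by (subst mat_mult_index) auto
    qed
    finally show ?thesis .
  qed
  have 2: "(T * \<rho> y) $$ (i, k) = (\<Sum>x\<in>carrier G. \<sigma> x $$ (i, j) * cnj (\<rho> (inv y \<otimes> x) $$ (k, l)))"
  proof -
    have "(T * \<rho> y) $$ (i, k) = (\<Sum>b<m. (\<Sum>x\<in>carrier G. \<sigma> x $$ (i, j) * cnj (\<rho> x $$ (b, l))) *
            \<rho> y $$ (b, k))"
      using i k ry T by (subst mat_mult_index) (auto simp: T_def intro!: sum.cong)
    also have "\<dots> = (\<Sum>x\<in>carrier G. \<sigma> x $$ (i, j) * cnj (\<Sum>b<m. cnj (\<rho> y $$ (b, k)) * \<rho> x $$ (b, l)))"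
      unfolding sum_distrib_left sum_distrib_right cnj_sum
      by (subst sum.swap) (simp add: mult_ac)
    also have "\<dots> = (\<Sum>x\<in>carrier G. \<sigma> x $$ (i, j) * cnj (\<rho> (inv y \<otimes> x) $$ (k, l)))"
    proof (rule sum.cong[OF refl])
      fix x assume x: "x \<in> carrier G"
      have "(\<Sum>b<m. cnj (\<rho> y $$ (b, k)) * \<rho> x $$ (b, l)) = \<rho> (inv y \<otimes> x) $$ (k, l)"
        unfolding unitary_rep_mult[OF \<rho> inv_closed[OF y] x] unitary_rep_inv[OF \<rho> y]
        using k l ry unitary_repD(1)[OF \<rho> x]
        by (subst mat_mult_index) (auto intro!: sum.cong)
      then show "\<sigma> x $$ (i, j) * cnj (\<Sum>b<m. cnj (\<rho> y $$ (b, k)) * \<rho> x $$ (b, l)) =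
        \<sigma> x $$ (i, j) * cnj (\<rho> (inv y \<otimes> x) $$ (k, l))" by simp
    qed
    finally show ?thesis .
  qed
  have "(T * \<rho> y) $$ (i, k) =
      (\<Sum>x\<in>carrier G. \<sigma> (y \<otimes> x) $$ (i, j) * cnj (\<rho> (inv y \<otimes> (y \<otimes> x)) $$ (k, l)))"
    unfolding 2 by (rule sum_carrier_translate[OF y, symmetric])
  also have "\<dots> = (\<sigma> y * T) $$ (i, k)"
    unfolding 1 using y by (intro sum.cong) (auto simp flip: m_assoc)
  finally show "(T * \<rho> y) $$ (i, k) = (\<sigma> y * T) $$ (i, k)" .
qed (use unitary_repD(1)[OF \<rho> y] unitary_repD(1)[OF \<sigma> y] in \<open>auto simp: T_def\<close>)

lemma coefficients_orthogonal_inequivalent: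
  assumes "irreducible_unitary_rep G m \<rho>" "irreducible_unitary_rep G n \<sigma>"
    and "\<not> equivalent_reps G m \<rho> n \<sigma>"
    and "i < n" "j < n" "k < m" "l < m"
  shows "(\<Sum>x\<in>carrier G. \<sigma> x $$ (i, j) * cnj (\<rho> x $$ (k, l))) = 0"
proof -
  define T where "T = mat n m (\<lambda>(i, k). \<Sum>x\<in>carrier G. \<sigma> x $$ (i, j) * cnj (\<rho> x $$ (k, l)))"
  have "T = 0\<^sub>m n m"
    by (rule schur_inequivalent[OF assms(1-3)])
      (auto simp: T_def intro!: averaged_intertwiner irreducibleD(1) assms)
  then have "T $$ (i, k) = 0" using assms by simp
  then show ?thesis using assms by (simp add: T_def)
qed

lemma coefficients_orthogonal:
  assumes irr: "irreducible_unitary_rep G n \<rho>"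
    and ij: "i < n" "j < n" and kl: "k < n" "l < n"
  shows "(\<Sum>x\<in>carrier G. \<rho> x $$ (i, j) * cnj (\<rho> x $$ (k, l))) =
    (if i = k \<and> j = l then of_nat (card (carrier G)) / of_nat n else 0)"
proof -
  note \<rho> = irreducibleD(1)[OF irr]
  define T where "T = mat n n (\<lambda>(i, k). \<Sum>x\<in>carrier G. \<rho> x $$ (i, j) * cnj (\<rho> x $$ (k, l)))"
  have T: "T \<in> carrier_mat n n" by (simp add: T_def)
  obtain c where c: "T = c \<cdot>\<^sub>m 1\<^sub>m n"
    by (rule schur_scalar[OF irr T averaged_intertwiner[OF \<rho> \<rho> ij(2) kl(2) _ T_def]])
  (* The scalar c is found from the trace, using unitarity of each value of the representation. *)
  have "of_nat n * c = mat_trace T" unfolding c mat_trace_def by simp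
  also have "\<dots> = (\<Sum>i<n. \<Sum>x\<in>carrier G. \<rho> x $$ (i, j) * cnj (\<rho> x $$ (i, l)))"
    by (simp add: mat_trace_def T_def)
  also have "\<dots> = (\<Sum>x\<in>carrier G. \<Sum>i<n. \<rho> x $$ (i, j) * cnj (\<rho> x $$ (i, l)))"
    by (rule sum.swap)
  also have "\<dots> = (\<Sum>x\<in>carrier G. if j = l then 1 else 0)"
  proof (rule sum.cong[OF refl])
    fix x assume x: "x \<in> carrier G"
    note rx = unitary_repD[OF \<rho> x]
    have "(\<Sum>i<n. \<rho> x $$ (i, j) * cnj (\<rho> x $$ (i, l))) = (adj (\<rho> x) * \<rho> x) $$ (l, j)"
      using rx(1) ij kl by (subst mat_mult_index) (auto intro!: sum.cong)
    then show "(\<Sum>i<n. \<rho> x $$ (i, j) * cnj (\<rho> x $$ (i, l))) = (if j = l then 1 else 0)"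
      using ij kl by (simp add: rx(3))
  qed
  finally have "of_nat n * c = (if j = l then of_nat (card (carrier G)) else 0)" by simp
  then have cval: "c = (if j = l then of_nat (card (carrier G)) / of_nat n else 0)"
    using irreducibleD(2)[OF irr] by (auto simp: field_simps split: if_splits)
  have "(\<Sum>x\<in>carrier G. \<rho> x $$ (i, j) * cnj (\<rho> x $$ (k, l))) = T $$ (i, k)"
    using ij kl by (simp add: T_def)
  also have "\<dots> = (if i = k then c else 0)" unfolding c using ij kl by simp
  finally show ?thesis by (simp add: cval)
qed

end


section \<open>Decomposition of reducible representations\<close>

context group
begin

text \<open>The restriction of \<open>\<rho>\<close> to the range of the isometry \<open>U\<close>, in the orthonormal basis given by
  the columns of \<open>U\<close>. That range is invariant because its projection commutes with \<open>\<rho>\<close>.\<close>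

lemma unitary_rep_restrict:
  assumes \<rho>: "unitary_rep G n \<rho>"
    and U: "U \<in> carrier_mat n m" and iso: "adj U * U = 1\<^sub>m m"
    and comm: "\<And>x. x \<in> carrier G \<Longrightarrow> (U * adj U) * \<rho> x = \<rho> x * (U * adj U)"
  shows "unitary_rep G m (\<lambda>x. adj U * \<rho> x * U)"
proof (rule unitary_repI)
  have U': "adj U \<in> carrier_mat m n" using U by simp
  have absorb: "adj U * (U * adj U) = adj U"
    using assoc_mult_mat[OF U' U U'] left_mult_one_mat[OF U'] by (simp add: iso)
  have move: "adj U * \<rho> x * (U * adj U) = adj U * \<rho> x" if x: "x \<in> carrier G" for x
  proof -
    note rx = unitary_repD(1)[OF \<rho> x]
    have "adj U * \<rho> x * (U * adj U) = adj U * (\<rho> x * (U * adj U))"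
      using U rx by (intro mat_mult_assoc) auto
    also have "\<dots> = (adj U * (U * adj U)) * \<rho> x"
      unfolding comm[OF x, symmetric] using U rx by (intro mat_mult_assoc[symmetric]) auto
    finally show ?thesis by (simp only: absorb)
  qed
  fix x assume x: "x \<in> carrier G"
  note rx = unitary_repD[OF \<rho> x]
  show "adj U * \<rho> x * U \<in> carrier_mat m m" using U rx(1) by auto
  have "(adj U * \<rho> x * U) * adj (adj U * \<rho> x * U) = (adj U * \<rho> x * U) * (adj U * (adj (\<rho> x) * U))"
    using U rx(1) by (simp add: adj_mult)
  also have "\<dots> = (adj U * \<rho> x * (U * adj U)) * (adj (\<rho> x) * U)"
    using U rx(1) by (simp add: mat_mult_assoc)
  also have "\<dots> = adj U * ((\<rho> x * adj (\<rho> x)) * U)"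
    unfolding move[OF x] using U rx(1) by (simp add: mat_mult_assoc)
  also have "\<dots> = 1\<^sub>m m" using U by (simp add: rx(2) iso)
  finally show "(adj U * \<rho> x * U) * adj (adj U * \<rho> x * U) = 1\<^sub>m m" .
  fix y assume y: "y \<in> carrier G"
  note ry = unitary_repD[OF \<rho> y]
  have "(adj U * \<rho> x * U) * (adj U * \<rho> y * U) = (adj U * \<rho> x * (U * adj U)) * (\<rho> y * U)"
    using U rx(1) ry(1) by (simp add: mat_mult_assoc)
  also have "\<dots> = adj U * \<rho> (x \<otimes> y) * U"
    unfolding move[OF x] unitary_rep_mult[OF \<rho> x y] using U rx(1) ry(1) by (simp add: mat_mult_assoc)
  finally show "adj U * \<rho> (x \<otimes> y) * U = (adj U * \<rho> x * U) * (adj U * \<rho> y * U)" by simp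
qed

text \<open>The orthogonal complement of an invariant subspace is invariant because the representation
  is unitary; the two orthogonal projections are \<open>U\<^sub>1 * adj U\<^sub>1\<close> and \<open>U\<^sub>2 * adj U\<^sub>2\<close>.\<close>

lemma reducible_rep_splits:
  assumes \<rho>: "unitary_rep G n \<rho>" and n: "0 < n" and red: "\<not> irreducible_unitary_rep G n \<rho>"
  obtains m\<^sub>1 U\<^sub>1 m\<^sub>2 U\<^sub>2 where
    "m\<^sub>1 < n" "U\<^sub>1 \<in> carrier_mat n m\<^sub>1" "unitary_rep G m\<^sub>1 (\<lambda>x. adj U\<^sub>1 * \<rho> x * U\<^sub>1)"
    "m\<^sub>2 < n" "U\<^sub>2 \<in> carrier_mat n m\<^sub>2" "unitary_rep G m\<^sub>2 (\<lambda>x. adj U\<^sub>2 * \<rho> x * U\<^sub>2)"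
    "\<And>x. x \<in> carrier G \<Longrightarrow> \<rho> x = U\<^sub>1 * (adj U\<^sub>1 * \<rho> x * U\<^sub>1) * adj U\<^sub>1 + U\<^sub>2 * (adj U\<^sub>2 * \<rho> x * U\<^sub>2) * adj U\<^sub>2"
proof -
  have "\<exists>W. invariant_subspace G n \<rho> W \<and> W \<noteq> {0\<^sub>v n} \<and> W \<noteq> carrier_vec n"
    using \<rho> n red by (simp add: irreducible_unitary_rep_def)
  then obtain W where inv: "invariant_subspace G n \<rho> W" and W: "W \<noteq> {0\<^sub>v n}" "W \<noteq> carrier_vec n"
    by blast
  have sub: "VectorSpace.subspace class_ring W (module_vec TYPE(complex) n)"
    and stable: "\<And>x w. x \<in> carrier G \<Longrightarrow> w \<in> W \<Longrightarrow> \<rho> x *\<^sub>v w \<in> W"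
    using inv by (auto simp: invariant_subspace_def)
  have WC: "W \<subseteq> carrier_vec n" and W0: "0\<^sub>v n \<in> W" using sub unfolding subspace_iff by auto
  obtain m\<^sub>1 U\<^sub>1 where U1: "U\<^sub>1 \<in> carrier_mat n m\<^sub>1" and iso1: "adj U\<^sub>1 * U\<^sub>1 = 1\<^sub>m m\<^sub>1"
    and less1: "W \<noteq> carrier_vec n \<Longrightarrow> m\<^sub>1 < n"
    and fix1: "\<And>v. v \<in> W \<Longrightarrow> (U\<^sub>1 * adj U\<^sub>1) *\<^sub>v v = v" and col1: "\<And>j. j < m\<^sub>1 \<Longrightarrow> col U\<^sub>1 j \<in> W"
    and fixB1: "\<And>B p. B \<in> carrier_mat n p \<Longrightarrow> (\<And>j. j < p \<Longrightarrow> col B j \<in> W) \<Longrightarrow> (U\<^sub>1 * adj U\<^sub>1) * B = B"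
    using subspace_isometry[OF sub] by metis
  define P where "P = U\<^sub>1 * adj U\<^sub>1"
  have P: "P \<in> carrier_mat n n" using U1 by (auto simp: P_def)
  have Padj: "adj P = P" using U1 by (simp add: P_def adj_mult)
  have PU1: "P * U\<^sub>1 = U\<^sub>1" unfolding P_def by (rule fixB1[OF U1 col1])
  have PP: "P * P = P"
  proof -
    have "P * P = (P * U\<^sub>1) * adj U\<^sub>1"
      unfolding P_def using U1 by (intro mat_mult_assoc[symmetric]) auto
    then have "P * P = U\<^sub>1 * adj U\<^sub>1" by (simp only: PU1)
    then show ?thesis by (simp only: P_def)
  qed
  have PrP: "P * (\<rho> x * P) = \<rho> x * P" if x: "x \<in> carrier G" for x
  proof -
    note rx = unitary_repD(1)[OF \<rho> x]
    have "P * (\<rho> x * U\<^sub>1) = \<rho> x * U\<^sub>1"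
      unfolding P_def using rx U1
    proof (intro fixB1)
      fix j assume j: "j < m\<^sub>1"
      show "col (\<rho> x * U\<^sub>1) j \<in> W"
        unfolding col_mult2[OF rx U1 j] by (rule stable[OF x col1[OF j]])
    qed auto
    moreover have "P * (\<rho> x * P) = (P * (\<rho> x * U\<^sub>1)) * adj U\<^sub>1" "\<rho> x * P = (\<rho> x * U\<^sub>1) * adj U\<^sub>1"
      using rx U1 by (simp_all add: P_def mat_mult_assoc)
    ultimately show ?thesis by simp
  qed
  (* Invariance under the inverse of x, read off after taking adjoints. *)
  have comm1: "P * \<rho> x = \<rho> x * P" if x: "x \<in> carrier G" for x
  proof -
    note rx = unitary_repD(1)[OF \<rho> x]
    have "P * (adj (\<rho> x) * P) = adj (\<rho> x) * P"
      using PrP[OF inv_closed[OF x]] by (simp add: unitary_rep_inv[OF \<rho> x])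
    then have "adj (P * (adj (\<rho> x) * P)) = adj (adj (\<rho> x) * P)" by simp
    then have "(P * \<rho> x) * P = P * \<rho> x" using rx P by (simp add: adj_mult Padj)
    moreover have "(P * \<rho> x) * P = P * (\<rho> x * P)" using rx P by (intro mat_mult_assoc) auto
    ultimately show ?thesis using PrP[OF x] by simp
  qed
  define W' where "W' = {v \<in> carrier_vec n. P *\<^sub>v v = 0\<^sub>v n}"
  have sub': "VectorSpace.subspace class_ring W' (module_vec TYPE(complex) n)"
    unfolding subspace_iff
  proof (intro conjI ballI allI)
    show "0\<^sub>v n \<in> W'" using P unfolding W'_def by (auto intro!: eq_vecI)
  next
    fix v w assume "v \<in> W'" "w \<in> W'"
    then show "v + w \<in> W'" using P by (simp add: W'_def mult_add_distrib_mat_vec[OF P])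
  next
    fix a v assume "v \<in> W'"
    then show "a \<cdot>\<^sub>v v \<in> W'"
      using P by (auto simp: W'_def mult_mat_vec[OF P] intro!: eq_vecI)
  qed (auto simp: W'_def)
  obtain m\<^sub>2 U\<^sub>2 where U2: "U\<^sub>2 \<in> carrier_mat n m\<^sub>2" and iso2: "adj U\<^sub>2 * U\<^sub>2 = 1\<^sub>m m\<^sub>2"
    and less2: "W' \<noteq> carrier_vec n \<Longrightarrow> m\<^sub>2 < n"
    and "\<And>v. v \<in> W' \<Longrightarrow> (U\<^sub>2 * adj U\<^sub>2) *\<^sub>v v = v" and col2: "\<And>j. j < m\<^sub>2 \<Longrightarrow> col U\<^sub>2 j \<in> W'"
    and fixB2: "\<And>B p. B \<in> carrier_mat n p \<Longrightarrow> (\<And>j. j < p \<Longrightarrow> col B j \<in> W') \<Longrightarrow> (U\<^sub>2 * adj U\<^sub>2) * B = B"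
    using subspace_isometry[OF sub'] by metis
  define Q where "Q = U\<^sub>2 * adj U\<^sub>2"
  have Q: "Q \<in> carrier_mat n n" using U2 by (auto simp: Q_def)
  have Qadj: "adj Q = Q" using U2 by (simp add: Q_def adj_mult)
  have "P * U\<^sub>2 = 0\<^sub>m n m\<^sub>2"
  proof (rule mat_col_eqI)
    fix j assume "j < dim_col (0\<^sub>m n m\<^sub>2 :: complex mat)"
    then have j: "j < m\<^sub>2" by simp
    show "col (P * U\<^sub>2) j = col (0\<^sub>m n m\<^sub>2) j"
      unfolding col_mult2[OF P U2 j] using col2[OF j] j by (simp add: W'_def)
  qed (use P U2 in auto)
  then have "P * Q = 0\<^sub>m n n"
    unfolding Q_def using assoc_mult_mat[OF P U2 adj_carrier[OF U2]] U2 by simp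
  then have "adj (P * Q) = adj (0\<^sub>m n n)" by simp
  moreover have "adj (0\<^sub>m n n) = 0\<^sub>m n n" by (rule eq_matI) auto
  ultimately have QP: "Q * P = 0\<^sub>m n n" using P Q by (simp add: adj_mult Padj Qadj)
  have Q_eq: "Q = 1\<^sub>m n - P"
  proof -
    have R: "1\<^sub>m n - P \<in> carrier_mat n n" using P by (simp add: minus_carrier_mat)
    have PR: "P * (1\<^sub>m n - P) = 0\<^sub>m n n"
      unfolding mult_minus_distrib_mat[OF P one_carrier_mat P] PP using P by auto
    have "Q * (1\<^sub>m n - P) = 1\<^sub>m n - P"
      unfolding Q_def
    proof (rule fixB2[OF R])
      fix j assume j: "j < n"
      have "P *\<^sub>v col (1\<^sub>m n - P) j = col (P * (1\<^sub>m n - P)) j" by (rule col_mult2[OF P R j, symmetric])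
      then show "col (1\<^sub>m n - P) j \<in> W'"
        unfolding PR W'_def using R j by auto
    qed
    moreover have "Q * (1\<^sub>m n - P) = Q"
      unfolding mult_minus_distrib_mat[OF Q one_carrier_mat P] QP using Q by auto
    ultimately show ?thesis by simp
  qed
  have comm2: "Q * \<rho> x = \<rho> x * Q" if x: "x \<in> carrier G" for x
  proof -
    note rx = unitary_repD(1)[OF \<rho> x]
    show ?thesis
      unfolding Q_eq minus_mult_distrib_mat[OF one_carrier_mat P rx]
        mult_minus_distrib_mat[OF rx one_carrier_mat P] comm1[OF x] using rx by simp
  qed
  have QQ: "Q * Q = Q"
    unfolding mult_minus_distrib_mat[OF Q one_carrier_mat P, folded Q_eq] QP using Q by auto
  have "W' \<noteq> carrier_vec n"
  proof
    assume "W' = carrier_vec n"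
    have "w = 0\<^sub>v n" if w: "w \<in> W" for w
    proof -
      have "w \<in> W'" using w WC \<open>W' = carrier_vec n\<close> by blast
      then show ?thesis using fix1[OF w] by (simp add: W'_def P_def)
    qed
    with W W0 show False by blast
  qed
  then have m2: "m\<^sub>2 < n" by (rule less2)
  have m1: "m\<^sub>1 < n" by (rule less1[OF W(2)])
  have decomp: "\<rho> x = U\<^sub>1 * (adj U\<^sub>1 * \<rho> x * U\<^sub>1) * adj U\<^sub>1 + U\<^sub>2 * (adj U\<^sub>2 * \<rho> x * U\<^sub>2) * adj U\<^sub>2"
    if x: "x \<in> carrier G" for x
  proof -
    note rx = unitary_repD(1)[OF \<rho> x]
    have "U\<^sub>1 * (adj U\<^sub>1 * \<rho> x * U\<^sub>1) * adj U\<^sub>1 = P * (\<rho> x * P)"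
      using U1 rx by (simp add: P_def mat_mult_assoc)
    also have "\<dots> = P * \<rho> x" unfolding comm1[OF x] by (rule PrP[OF x])
    finally have 1: "U\<^sub>1 * (adj U\<^sub>1 * \<rho> x * U\<^sub>1) * adj U\<^sub>1 = P * \<rho> x" .
    have "U\<^sub>2 * (adj U\<^sub>2 * \<rho> x * U\<^sub>2) * adj U\<^sub>2 = Q * (\<rho> x * Q)"
      using U2 rx by (simp add: Q_def mat_mult_assoc)
    also have "\<dots> = (Q * Q) * \<rho> x"
      unfolding comm2[OF x, symmetric] using Q rx by (intro mat_mult_assoc[symmetric]) auto
    finally have 2: "U\<^sub>2 * (adj U\<^sub>2 * \<rho> x * U\<^sub>2) * adj U\<^sub>2 = Q * \<rho> x" unfolding QQ .
    have "P * \<rho> x + Q * \<rho> x = (P + Q) * \<rho> x" by (rule add_mult_distrib_mat[OF P Q rx, symmetric])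
    also have "P + Q = 1\<^sub>m n" unfolding Q_eq using P by (intro eq_matI) auto
    finally show ?thesis unfolding 1 2 using rx by simp
  qed
  show ?thesis
  proof (rule that[OF m1 U1 _ m2 U2 _ decomp])
    show "unitary_rep G m\<^sub>1 (\<lambda>x. adj U\<^sub>1 * \<rho> x * U\<^sub>1)"
      by (rule unitary_rep_restrict[OF \<rho> U1 iso1 comm1[unfolded P_def]])
    show "unitary_rep G m\<^sub>2 (\<lambda>x. adj U\<^sub>2 * \<rho> x * U\<^sub>2)"
      by (rule unitary_rep_restrict[OF \<rho> U2 iso2 comm2[unfolded Q_def]])
  qed
qed

end


section \<open>Completeness of the matrix coefficients\<close>

text \<open>A finite group with a complete system of irreducible unitary representations.\<close>

locale irrep_system = group G for G :: "('g, 'b) monoid_scheme" (structure) +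
  fixes k :: nat and d :: "nat \<Rightarrow> nat" and \<pi> :: "nat \<Rightarrow> 'g \<Rightarrow> complex mat"
  assumes finite_carrier: "finite (carrier G)"
    and system: "complete_irrep_system G k d \<pi>"
begin

lemma irrep: "r \<in> {1..k} \<Longrightarrow> irreducible_unitary_rep G (d r) (\<pi> r)"
  using system by (auto simp: complete_irrep_system_def)

lemma inequivalent:
  "r \<in> {1..k} \<Longrightarrow> s \<in> {1..k} \<Longrightarrow> r \<noteq> s \<Longrightarrow> \<not> equivalent_reps G (d r) (\<pi> r) (d s) (\<pi> s)"
  using system by (auto simp: complete_irrep_system_def)

lemma equivalent_to_member:
  assumes "irreducible_unitary_rep G n \<rho>"
  obtains r where "r \<in> {1..k}" "equivalent_reps G n \<rho> (d r) (\<pi> r)"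
  using system assms unfolding complete_irrep_system_def by blast

text \<open>The linear combination of matrix coefficients of \<open>\<pi>\<^sup>r\<close> with coefficient array \<open>c\<close>.\<close>

definition coeff_comb :: "nat \<Rightarrow> (nat \<Rightarrow> nat \<Rightarrow> complex) \<Rightarrow> 'g \<Rightarrow> complex" where
  "coeff_comb r c x = (\<Sum>i<d r. \<Sum>j<d r. c i j * \<pi> r x $$ (i, j))"

text \<open>Functions that agree on the group with a linear combination of the matrix coefficients of
  the whole system; values off the carrier are disregarded.\<close>

definition coeff_span :: "('g \<Rightarrow> complex) set" where
  "coeff_span = {f. \<exists>c. \<forall>x\<in>carrier G. f x = (\<Sum>r\<in>{1..k}. coeff_comb r (c r) x)}"

lemma coeff_span_cong:
  "f \<in> coeff_span \<Longrightarrow> (\<And>x. x \<in> carrier G \<Longrightarrow> g x = f x) \<Longrightarrow> g \<in> coeff_span"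
  unfolding coeff_span_def by simp

lemma coeff_span_zero: "(\<lambda>x. 0) \<in> coeff_span"
  unfolding coeff_span_def coeff_comb_def by (auto intro!: exI[of _ "\<lambda>r i j. 0"])

lemma coeff_span_add:
  assumes "f \<in> coeff_span" "g \<in> coeff_span"
  shows "(\<lambda>x. f x + g x) \<in> coeff_span"
proof -
  obtain c c' where "\<And>x. x \<in> carrier G \<Longrightarrow> f x = (\<Sum>r\<in>{1..k}. coeff_comb r (c r) x)"
    "\<And>x. x \<in> carrier G \<Longrightarrow> g x = (\<Sum>r\<in>{1..k}. coeff_comb r (c' r) x)"
    using assms by (auto simp: coeff_span_def)
  then have "\<forall>x\<in>carrier G. f x + g x = (\<Sum>r\<in>{1..k}. coeff_comb r (\<lambda>i j. c r i j + c' r i j) x)"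
    by (simp add: coeff_comb_def sum.distrib distrib_right)
  then show ?thesis unfolding coeff_span_def by (auto intro!: exI[of _ "\<lambda>r i j. c r i j + c' r i j"])
qed

lemma coeff_span_scale:
  assumes "f \<in> coeff_span"
  shows "(\<lambda>x. a * f x) \<in> coeff_span"
proof -
  obtain c where "\<And>x. x \<in> carrier G \<Longrightarrow> f x = (\<Sum>r\<in>{1..k}. coeff_comb r (c r) x)"
    using assms by (auto simp: coeff_span_def)
  then have "\<forall>x\<in>carrier G. a * f x = (\<Sum>r\<in>{1..k}. coeff_comb r (\<lambda>i j. a * c r i j) x)"
    by (simp add: coeff_comb_def sum_distrib_left mult.assoc)
  then show ?thesis unfolding coeff_span_def by (auto intro!: exI[of _ "\<lambda>r i j. a * c r i j"])
qed

lemma coeff_span_sum: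
  assumes "finite I" "\<And>i. i \<in> I \<Longrightarrow> f i \<in> coeff_span"
  shows "(\<lambda>x. \<Sum>i\<in>I. f i x) \<in> coeff_span"
  using assms by (induction I rule: finite_induct) (auto simp: coeff_span_zero intro!: coeff_span_add)

lemma coefficient_in_coeff_span:
  assumes r: "r \<in> {1..k}" and ij: "i < d r" "j < d r"
  shows "(\<lambda>x. \<pi> r x $$ (i, j)) \<in> coeff_span"
proof -
  define c where "c s a b = (if s = r \<and> a = i \<and> b = j then 1 else 0 :: complex)" for s a b
  have "coeff_comb s (c s) x = (if s = r then \<pi> r x $$ (i, j) else 0)" for s x
  proof (cases "s = r")
    case True
    have c_mult: "c r a b * w = (if a = i then if b = j then w else 0 else 0)" for a b w
      by (simp add: c_def)
    have "coeff_comb r (c r) x =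
        (\<Sum>a<d r. if a = i then \<Sum>b<d r. if b = j then \<pi> r x $$ (a, b) else 0 else 0)"
      unfolding coeff_comb_def c_mult by (intro sum.cong) auto
    with True show ?thesis using ij by simp
  qed (simp add: coeff_comb_def c_def)
  then show ?thesis unfolding coeff_span_def using r by (auto intro!: exI[of _ c])
qed

lemma sandwich_in_coeff_span:
  assumes A: "A \<in> carrier_mat n m" and B: "B \<in> carrier_mat m p"
    and \<sigma>: "\<And>x. x \<in> carrier G \<Longrightarrow> \<sigma> x \<in> carrier_mat m m"
    and span: "\<And>a b. a < m \<Longrightarrow> b < m \<Longrightarrow> (\<lambda>x. \<sigma> x $$ (a, b)) \<in> coeff_span"
    and i: "i < n" and j: "j < p"
  shows "(\<lambda>x. (A * \<sigma> x * B) $$ (i, j)) \<in> coeff_span"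
proof (rule coeff_span_cong)
  show "(\<lambda>x. \<Sum>b<m. \<Sum>a<m. (A $$ (i, a) * B $$ (b, j)) * \<sigma> x $$ (a, b)) \<in> coeff_span"
    by (intro coeff_span_sum coeff_span_scale span) auto
  fix x assume x: "x \<in> carrier G"
  have "(A * \<sigma> x * B) $$ (i, j) = (\<Sum>b<m. (A * \<sigma> x) $$ (i, b) * B $$ (b, j))"
    using A B \<sigma>[OF x] i j by (subst mat_mult_index) auto
  also have "\<dots> = (\<Sum>b<m. (\<Sum>a<m. A $$ (i, a) * \<sigma> x $$ (a, b)) * B $$ (b, j))"
    using A \<sigma>[OF x] i by (intro sum.cong refl) (subst mat_mult_index, auto)
  finally show "(A * \<sigma> x * B) $$ (i, j) = (\<Sum>b<m. \<Sum>a<m. (A $$ (i, a) * B $$ (b, j)) * \<sigma> x $$ (a, b))"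
    by (simp add: sum_distrib_left mult_ac)
qed

text \<open>Complete reducibility, by strong induction on the degree.\<close>

lemma unitary_rep_coefficient_in_coeff_span:
  assumes "unitary_rep G n \<rho>" "i < n" "j < n"
  shows "(\<lambda>x. \<rho> x $$ (i, j)) \<in> coeff_span"
  using assms
proof (induction n arbitrary: \<rho> i j rule: less_induct)
  case (less n)
  note \<rho> = less.prems(1)
  show ?case
  proof (cases "irreducible_unitary_rep G n \<rho>")
    case True
    then obtain r where r: "r \<in> {1..k}" and "equivalent_reps G n \<rho> (d r) (\<pi> r)"
      by (rule equivalent_to_member)
    then obtain T where T: "T \<in> carrier_mat (d r) n" and "invertible_mat T"
      and comm: "\<And>x. x \<in> carrier G \<Longrightarrow> T * \<rho> x = \<pi> r x * T"
      by (auto simp: equivalent_reps_def)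
    then obtain S where TS: "T * S = 1\<^sub>m (d r)" and ST: "S * T = 1\<^sub>m (dim_row S)"
      by (auto simp: invertible_mat_def inverts_mat_def)
    have "dim_col S = d r" using arg_cong[OF TS, of dim_col] by simp
    moreover have "dim_row S = n" using arg_cong[OF ST, of dim_col] T by simp
    ultimately have S: "S \<in> carrier_mat n (d r)" by auto
    have "(\<lambda>x. (S * \<pi> r x * T) $$ (i, j)) \<in> coeff_span"
      by (rule sandwich_in_coeff_span[OF S T _ coefficient_in_coeff_span[OF r]])
        (use less.prems unitary_repD(1)[OF irreducibleD(1)[OF irrep[OF r]]] in auto)
    then show ?thesis
    proof (rule coeff_span_cong)
      fix x assume x: "x \<in> carrier G"
      note rx = unitary_repD(1)[OF \<rho> x] and px = unitary_repD(1)[OF irreducibleD(1)[OF irrep[OF r]] x]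
      have "S * \<pi> r x * T = S * (T * \<rho> x)"
        unfolding comm[OF x] using S T px by (intro mat_mult_assoc) auto
      also have "\<dots> = (S * T) * \<rho> x" using S T rx by (intro mat_mult_assoc[symmetric]) auto
      also have "\<dots> = \<rho> x" using ST S rx by simp
      finally show "\<rho> x $$ (i, j) = (S * \<pi> r x * T) $$ (i, j)" by simp
    qed
  next
    case False
    obtain m\<^sub>1 U\<^sub>1 m\<^sub>2 U\<^sub>2 where
      1: "m\<^sub>1 < n" "U\<^sub>1 \<in> carrier_mat n m\<^sub>1" "unitary_rep G m\<^sub>1 (\<lambda>x. adj U\<^sub>1 * \<rho> x * U\<^sub>1)"
      and 2: "m\<^sub>2 < n" "U\<^sub>2 \<in> carrier_mat n m\<^sub>2" "unitary_rep G m\<^sub>2 (\<lambda>x. adj U\<^sub>2 * \<rho> x * U\<^sub>2)"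
      and split: "\<And>x. x \<in> carrier G \<Longrightarrow>
        \<rho> x = U\<^sub>1 * (adj U\<^sub>1 * \<rho> x * U\<^sub>1) * adj U\<^sub>1 + U\<^sub>2 * (adj U\<^sub>2 * \<rho> x * U\<^sub>2) * adj U\<^sub>2"
      using reducible_rep_splits[OF \<rho> _ False] less.prems by (metis gr_zeroI less_zeroE)
    have s1: "(\<lambda>x. (U\<^sub>1 * (adj U\<^sub>1 * \<rho> x * U\<^sub>1) * adj U\<^sub>1) $$ (i, j)) \<in> coeff_span"
      by (rule sandwich_in_coeff_span[OF 1(2) adj_carrier[OF 1(2)] unitary_repD(1)[OF 1(3)]
            less.IH[OF 1(1,3)] less.prems(2,3)])
    have s2: "(\<lambda>x. (U\<^sub>2 * (adj U\<^sub>2 * \<rho> x * U\<^sub>2) * adj U\<^sub>2) $$ (i, j)) \<in> coeff_span"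
      by (rule sandwich_in_coeff_span[OF 2(2) adj_carrier[OF 2(2)] unitary_repD(1)[OF 2(3)]
            less.IH[OF 2(1,3)] less.prems(2,3)])
    show ?thesis
    proof (rule coeff_span_cong[OF coeff_span_add[OF s1 s2]])
      fix x assume x: "x \<in> carrier G"
      show "\<rho> x $$ (i, j) = (U\<^sub>1 * (adj U\<^sub>1 * \<rho> x * U\<^sub>1) * adj U\<^sub>1) $$ (i, j) +
          (U\<^sub>2 * (adj U\<^sub>2 * \<rho> x * U\<^sub>2) * adj U\<^sub>2) $$ (i, j)"
        using 1(2) 2(2) less.prems(2,3) by (subst split[OF x]) simp
    qed
  qed
qed

text \<open>The right regular representation, as permutation matrices with respect to an enumeration
  of the group, has every delta function among its matrix coefficients.\<close>

lemma delta_in_coeff_span: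
  assumes z: "z \<in> carrier G"
  shows "(\<lambda>x. if x = z then 1 else 0) \<in> coeff_span"
proof -
  define n where "n = card (carrier G)"
  obtain g where g: "bij_betw g {..<n} (carrier G)"
    using ex_bij_betw_nat_finite[OF finite_carrier] by (auto simp: n_def atLeast0LessThan)
  have gG: "g a \<in> carrier G" if "a < n" for a using g that by (auto simp: bij_betw_def)
  have ginj: "g a = g b \<longleftrightarrow> a = b" if "a < n" "b < n" for a b
    using g that by (auto simp: bij_betw_def inj_on_def)
  have gsurj: "\<exists>a<n. g a = y" if "y \<in> carrier G" for y
    using g that by (metis bij_betw_imp_surj_on imageE lessThan_iff)
  (* The matrix of right translation by x, with entry 1 at (a, b) when g b is g a times x. *)
  define \<rho> where "\<rho> x = mat n n (\<lambda>(a, b). if g b = g a \<otimes> x then 1 else 0 :: complex)" for x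
  have "unitary_rep G n \<rho>"
  proof (rule unitary_repI)
    fix x assume x: "x \<in> carrier G"
    show "\<rho> x \<in> carrier_mat n n" by (simp add: \<rho>_def)
    (* Row a has its only nonzero entry at the index of g a times x. *)
    have pick: "(\<Sum>b<n. (if g b = g a \<otimes> x then 1 else 0) * F (g b)) = F (g a \<otimes> x)"
      if a: "a < n" for a and F :: "'g \<Rightarrow> complex"
    proof -
      have "(\<Sum>b<n. (if g b = g a \<otimes> x then 1 else 0) * F (g b)) =
          (\<Sum>y\<in>carrier G. (if y = g a \<otimes> x then 1 else 0) * F y)"
        by (rule sum.reindex_bij_betw[OF g])
      also have "\<dots> = (\<Sum>y\<in>carrier G. if y = g a \<otimes> x then F y else 0)"
        by (intro sum.cong) auto
      also have "\<dots> = F (g a \<otimes> x)"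
        using x gG[OF a] finite_carrier by (simp add: sum.delta)
      finally show ?thesis .
    qed
    show "\<rho> x * adj (\<rho> x) = 1\<^sub>m n"
    proof (rule eq_matI)
      fix a c assume "a < dim_row (1\<^sub>m n :: complex mat)" "c < dim_col (1\<^sub>m n :: complex mat)"
      then have ac: "a < n" "c < n" by auto
      have "(\<rho> x * adj (\<rho> x)) $$ (a, c) =
          (\<Sum>b<n. (if g b = g a \<otimes> x then 1 else 0) * (if g b = g c \<otimes> x then 1 else 0))"
        using ac by (subst mat_mult_index) (auto simp: \<rho>_def intro!: sum.cong)
      also have "\<dots> = (if g a \<otimes> x = g c \<otimes> x then 1 else 0)" by (rule pick[OF ac(1)])
      also have "\<dots> = 1\<^sub>m n $$ (a, c)" using ac x gG ginj by simp
      finally show "(\<rho> x * adj (\<rho> x)) $$ (a, c) = 1\<^sub>m n $$ (a, c)" .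
    qed (auto simp: \<rho>_def)
    fix y assume y: "y \<in> carrier G"
    show "\<rho> (x \<otimes> y) = \<rho> x * \<rho> y"
    proof (rule eq_matI)
      fix a c assume "a < dim_row (\<rho> x * \<rho> y)" "c < dim_col (\<rho> x * \<rho> y)"
      then have ac: "a < n" "c < n" by (auto simp: \<rho>_def)
      have "(\<rho> x * \<rho> y) $$ (a, c) =
          (\<Sum>b<n. (if g b = g a \<otimes> x then 1 else 0) * (if g c = g b \<otimes> y then 1 else 0))"
        using ac by (subst mat_mult_index) (auto simp: \<rho>_def intro!: sum.cong)
      also have "\<dots> = (if g c = g a \<otimes> x \<otimes> y then 1 else 0)" by (rule pick[OF ac(1)])
      also have "\<dots> = \<rho> (x \<otimes> y) $$ (a, c)" using ac x y gG by (simp add: \<rho>_def m_assoc)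
      finally show "\<rho> (x \<otimes> y) $$ (a, c) = (\<rho> x * \<rho> y) $$ (a, c)" by simp
    qed (auto simp: \<rho>_def)
  qed
  moreover obtain a where a: "a < n" "g a = \<one>" using gsurj[OF one_closed] by blast
  moreover obtain b where b: "b < n" "g b = z" using gsurj[OF z] by blast
  ultimately have "(\<lambda>x. \<rho> x $$ (a, b)) \<in> coeff_span"
    by (intro unitary_rep_coefficient_in_coeff_span)
  then show ?thesis
    by (rule coeff_span_cong) (use a b in \<open>auto simp: \<rho>_def\<close>)
qed

lemma coefficients_complete: "f \<in> coeff_span"
proof (rule coeff_span_cong)
  show "(\<lambda>x. \<Sum>z\<in>carrier G. f z * (if x = z then 1 else 0)) \<in> coeff_span"
    by (intro coeff_span_sum coeff_span_scale delta_in_coeff_span finite_carrier)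
  fix x assume "x \<in> carrier G"
  then show "f x = (\<Sum>z\<in>carrier G. f z * (if x = z then 1 else 0))"
    using finite_carrier by (simp add: if_distrib sum.delta cong: if_cong)
qed

end


section \<open>The isotypic decomposition of a function\<close>

context irrep_system
begin

lemma irrep_carrier:
  "r \<in> {1..k} \<Longrightarrow> x \<in> carrier G \<Longrightarrow> \<pi> r x \<in> carrier_mat (d r) (d r)"
  using unitary_repD(1)[OF irreducibleD(1)[OF irrep]] .

lemma degree_pos: "r \<in> {1..k} \<Longrightarrow> 0 < d r"
  using irreducibleD(2)[OF irrep] .

lemma card_pos: "0 < card (carrier G)"
  using finite_carrier one_closed by (auto simp: card_gt_0_iff)

lemma schur_orthogonality:
  assumes r: "r \<in> {1..k}" and s: "s \<in> {1..k}"
    and "i < d r" "j < d r" "a < d s" "b < d s"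
  shows "(\<Sum>x\<in>carrier G. \<pi> r x $$ (i, j) * cnj (\<pi> s x $$ (a, b))) =
    (if r = s \<and> i = a \<and> j = b then of_nat (card (carrier G)) / of_nat (d r) else 0)"
proof (cases "r = s")
  case True
  then show ?thesis using coefficients_orthogonal[OF irrep[OF r]] assms by simp
next
  case False
  then show ?thesis
    using coefficients_orthogonal_inequivalent[OF irrep[OF s] irrep[OF r] inequivalent[OF s r]] assms
    by simp
qed

text \<open>\<open>coeff_comb r c\<close> pairs with the coefficient \<open>(a, b)\<close> of \<open>\<pi>\<^sup>s\<close> to \<open>|G| / d\<^sub>r\<close> times
  \<open>c a b\<close> if \<open>r = s\<close>, and to 0 otherwise.\<close>

lemma coeff_comb_inner_coefficient:
  assumes r: "r \<in> {1..k}" and s: "s \<in> {1..k}" and ab: "a < d s" "b < d s"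
  shows "(\<Sum>x\<in>carrier G. coeff_comb r c x * cnj (\<pi> s x $$ (a, b))) =
    (if r = s then of_nat (card (carrier G)) / of_nat (d r) * c a b else 0)"
proof -
  have "(\<Sum>x\<in>carrier G. coeff_comb r c x * cnj (\<pi> s x $$ (a, b))) =
      (\<Sum>x\<in>carrier G. \<Sum>i<d r. \<Sum>j<d r. c i j * (\<pi> r x $$ (i, j) * cnj (\<pi> s x $$ (a, b))))"
    by (simp add: coeff_comb_def sum_distrib_right mult.assoc)
  also have "\<dots> = (\<Sum>i<d r. \<Sum>x\<in>carrier G. \<Sum>j<d r. c i j * (\<pi> r x $$ (i, j) * cnj (\<pi> s x $$ (a, b))))"
    by (rule sum.swap)
  also have "\<dots> = (\<Sum>i<d r. \<Sum>j<d r. \<Sum>x\<in>carrier G. c i j * (\<pi> r x $$ (i, j) * cnj (\<pi> s x $$ (a, b))))"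
    by (intro sum.cong refl sum.swap)
  also have "\<dots> = (\<Sum>i<d r. \<Sum>j<d r. c i j * (\<Sum>x\<in>carrier G. \<pi> r x $$ (i, j) * cnj (\<pi> s x $$ (a, b))))"
    by (simp only: sum_distrib_left)
  also have "\<dots> = (\<Sum>i<d r. \<Sum>j<d r. if i = a then if j = b then
      (if r = s then of_nat (card (carrier G)) / of_nat (d r) * c a b else 0) else 0 else 0)"
  proof (intro sum.cong refl)
    fix i j assume "i \<in> {..<d r}" "j \<in> {..<d r}"
    then have ij: "i < d r" "j < d r" by auto
    show "c i j * (\<Sum>x\<in>carrier G. \<pi> r x $$ (i, j) * cnj (\<pi> s x $$ (a, b))) =
      (if i = a then if j = b then
        (if r = s then of_nat (card (carrier G)) / of_nat (d r) * c a b else 0) else 0 else 0)"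
      unfolding schur_orthogonality[OF r s ij ab] by simp
  qed
  also have "\<dots> = (\<Sum>i<d r. if i = a then \<Sum>j<d r. if j = b then
      (if r = s then of_nat (card (carrier G)) / of_nat (d r) * c a b else 0) else 0 else 0)"
    by (intro sum.cong) auto
  also have "\<dots> = (if r = s then of_nat (card (carrier G)) / of_nat (d r) * c a b else 0)"
    using ab by (cases "r = s") simp_all
  finally show ?thesis .
qed

lemma coeff_comb_inner:
  assumes r: "r \<in> {1..k}" and s: "s \<in> {1..k}"
  shows "(\<Sum>x\<in>carrier G. coeff_comb r c x * cnj (coeff_comb s c' x)) =
    (if r = s then of_nat (card (carrier G)) / of_nat (d r) *
       (\<Sum>i<d r. \<Sum>j<d r. c i j * cnj (c' i j)) else 0)"
proof -
  have "(\<Sum>x\<in>carrier G. coeff_comb r c x * cnj (coeff_comb s c' x)) =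
      (\<Sum>x\<in>carrier G. \<Sum>a<d s. \<Sum>b<d s. cnj (c' a b) * (coeff_comb r c x * cnj (\<pi> s x $$ (a, b))))"
    by (simp add: coeff_comb_def[of s] sum_distrib_left mult_ac)
  also have "\<dots> = (\<Sum>a<d s. \<Sum>x\<in>carrier G. \<Sum>b<d s. cnj (c' a b) * (coeff_comb r c x * cnj (\<pi> s x $$ (a, b))))"
    by (rule sum.swap)
  also have "\<dots> = (\<Sum>a<d s. \<Sum>b<d s. \<Sum>x\<in>carrier G. cnj (c' a b) * (coeff_comb r c x * cnj (\<pi> s x $$ (a, b))))"
    by (intro sum.cong refl sum.swap)
  also have "\<dots> = (\<Sum>a<d s. \<Sum>b<d s. cnj (c' a b) *
      (if r = s then of_nat (card (carrier G)) / of_nat (d r) * c a b else 0))"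
    unfolding sum_distrib_left[symmetric]
    by (intro sum.cong refl arg_cong[where f = "(*) _"] coeff_comb_inner_coefficient[OF r s]) auto
  also have "\<dots> = (if r = s then of_nat (card (carrier G)) / of_nat (d r) *
       (\<Sum>i<d r. \<Sum>j<d r. c i j * cnj (c' i j)) else 0)"
    by (simp add: sum_distrib_left mult_ac)
  finally show ?thesis .
qed

text \<open>The squared norm of \<open>coeff_comb r c\<close> in \<open>L\<^sup>2(G)\<close>, for \<open>r\<close> in the system.\<close>

definition component_energy :: "nat \<Rightarrow> (nat \<Rightarrow> nat \<Rightarrow> complex) \<Rightarrow> real" where
  "component_energy r c = (\<Sum>i<d r. \<Sum>j<d r. (cmod (c i j))\<^sup>2) / real (d r)"

lemma component_energy_nonneg: "0 \<le> component_energy r c"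
  unfolding component_energy_def by (intro divide_nonneg_nonneg sum_nonneg) auto

lemma parseval:
  "(\<Sum>x\<in>carrier G. (cmod (\<Sum>r\<in>{1..k}. a r * coeff_comb r (c r) x))\<^sup>2) =
    real (card (carrier G)) * (\<Sum>r\<in>{1..k}. (cmod (a r))\<^sup>2 * component_energy r (c r))"
proof -
  let ?n = "of_nat (card (carrier G)) :: complex"
  have "complex_of_real (\<Sum>x\<in>carrier G. (cmod (\<Sum>r\<in>{1..k}. a r * coeff_comb r (c r) x))\<^sup>2) =
      (\<Sum>x\<in>carrier G. (\<Sum>r\<in>{1..k}. a r * coeff_comb r (c r) x) *
         cnj (\<Sum>s\<in>{1..k}. a s * coeff_comb s (c s) x))"
    by (simp only: of_real_sum complex_norm_square)
  also have "\<dots> = (\<Sum>x\<in>carrier G. \<Sum>r\<in>{1..k}. \<Sum>s\<in>{1..k}.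
      a r * cnj (a s) * (coeff_comb r (c r) x * cnj (coeff_comb s (c s) x)))"
    by (simp only: sum_product cnj_sum complex_cnj_mult) (simp only: mult_ac)
  also have "\<dots> = (\<Sum>r\<in>{1..k}. \<Sum>x\<in>carrier G. \<Sum>s\<in>{1..k}.
      a r * cnj (a s) * (coeff_comb r (c r) x * cnj (coeff_comb s (c s) x)))"
    by (rule sum.swap)
  also have "\<dots> = (\<Sum>r\<in>{1..k}. \<Sum>s\<in>{1..k}. \<Sum>x\<in>carrier G.
      a r * cnj (a s) * (coeff_comb r (c r) x * cnj (coeff_comb s (c s) x)))"
    by (intro sum.cong refl sum.swap)
  also have "\<dots> = (\<Sum>r\<in>{1..k}. \<Sum>s\<in>{1..k}. if r = s then
      ?n * of_real ((cmod (a r))\<^sup>2 * component_energy r (c r)) else 0)"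
  proof (intro sum.cong refl)
    fix r s assume rs: "r \<in> {1..k}" "s \<in> {1..k}"
    have sq: "(\<Sum>i<d t. \<Sum>j<d t. c t i j * cnj (c t i j)) =
        of_real (\<Sum>i<d t. \<Sum>j<d t. (cmod (c t i j))\<^sup>2)" for t
      by (simp only: of_real_sum complex_norm_square)
    have "(\<Sum>x\<in>carrier G. a r * cnj (a s) * (coeff_comb r (c r) x * cnj (coeff_comb s (c s) x))) =
        a r * cnj (a s) * (if r = s then ?n / of_nat (d r) *
          (\<Sum>i<d r. \<Sum>j<d r. c r i j * cnj (c s i j)) else 0)"
      unfolding sum_distrib_left[symmetric] coeff_comb_inner[OF rs] ..
    also have "\<dots> = (if r = s then ?n * of_real ((cmod (a r))\<^sup>2 * component_energy r (c r)) else 0)"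
    proof (cases "r = s")
      case True
      have "a r * cnj (a r) * (?n / of_nat (d r) * of_real E) =
          ?n * of_real ((cmod (a r))\<^sup>2 * (E / real (d r)))" for r E
        unfolding of_real_mult complex_norm_square by (simp add: mult_ac)
      with True show ?thesis
        by (simp only: simp_thms if_True sq component_energy_def)
    qed simp
    finally show "(\<Sum>x\<in>carrier G. a r * cnj (a s) * (coeff_comb r (c r) x * cnj (coeff_comb s (c s) x))) =
        (if r = s then ?n * of_real ((cmod (a r))\<^sup>2 * component_energy r (c r)) else 0)" .
  qed
  also have "\<dots> = (\<Sum>r\<in>{1..k}. ?n * of_real ((cmod (a r))\<^sup>2 * component_energy r (c r)))"
    by (intro sum.cong refl) (simp add: sum.delta)
  also have "\<dots> = of_real (real (card (carrier G)) *
      (\<Sum>r\<in>{1..k}. (cmod (a r))\<^sup>2 * component_energy r (c r)))"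
    by (simp add: sum_distrib_left)
  finally show ?thesis by (simp only: of_real_eq_iff)
qed

lemma character_translate:
  assumes r: "r \<in> {1..k}" and h: "h \<in> carrier G" and x: "x \<in> carrier G"
  shows "rep_character (\<pi> r) (inv h \<otimes> x) =
    (\<Sum>a<d r. \<Sum>b<d r. cnj (\<pi> r h $$ (a, b)) * \<pi> r x $$ (a, b))"
proof -
  note \<rho> = irreducibleD(1)[OF irrep[OF r]]
  note hc = irrep_carrier[OF r h] and xc = irrep_carrier[OF r x]
  have E: "\<pi> r (inv h \<otimes> x) = adj (\<pi> r h) * \<pi> r x"
    by (simp add: unitary_rep_mult[OF \<rho> inv_closed[OF h] x] unitary_rep_inv[OF \<rho> h])
  have "rep_character (\<pi> r) (inv h \<otimes> x) = (\<Sum>b<d r. (adj (\<pi> r h) * \<pi> r x) $$ (b, b))"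
    unfolding rep_character_def E using hc by simp
  also have "\<dots> = (\<Sum>b<d r. \<Sum>a<d r. cnj (\<pi> r h $$ (a, b)) * \<pi> r x $$ (a, b))"
    using hc xc by (intro sum.cong refl) (subst mat_mult_index, auto intro!: sum.cong)
  also have "\<dots> = (\<Sum>a<d r. \<Sum>b<d r. cnj (\<pi> r h $$ (a, b)) * \<pi> r x $$ (a, b))"
    by (rule sum.swap)
  finally show ?thesis .
qed

text \<open>Pairing with the translates of \<open>\<chi>\<^sup>s\<close> is, up to the factor \<open>|G| / d\<^sub>s\<close>, the projection onto
  the isotypic component of \<open>\<pi>\<^sup>s\<close>.\<close>

lemma isotypic_projection:
  assumes r: "r \<in> {1..k}" and s: "s \<in> {1..k}" and h: "h \<in> carrier G"
  shows "(\<Sum>x\<in>carrier G. coeff_comb r c x * cnj (rep_character (\<pi> s) (inv h \<otimes> x))) =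
    (if r = s then of_nat (card (carrier G)) / of_nat (d r) * coeff_comb r c h else 0)"
proof -
  have "(\<Sum>x\<in>carrier G. coeff_comb r c x * cnj (rep_character (\<pi> s) (inv h \<otimes> x))) =
      (\<Sum>x\<in>carrier G. coeff_comb r c x * cnj (coeff_comb s (\<lambda>a b. cnj (\<pi> s h $$ (a, b))) x))"
    by (intro sum.cong refl) (simp only: character_translate[OF s h] coeff_comb_def)
  also have "\<dots> = (if r = s then of_nat (card (carrier G)) / of_nat (d r) *
       (\<Sum>i<d r. \<Sum>j<d r. c i j * cnj (cnj (\<pi> s h $$ (i, j)))) else 0)"
    by (rule coeff_comb_inner[OF r s])
  also have "\<dots> = (if r = s then of_nat (card (carrier G)) / of_nat (d r) * coeff_comb r c h else 0)"
    by (simp add: coeff_comb_def)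
  finally show ?thesis .
qed

lemma wavelet_transform:
  assumes f: "\<And>x. x \<in> carrier G \<Longrightarrow> f x = (\<Sum>r\<in>{1..k}. coeff_comb r (c r) x)"
    and h: "h \<in> carrier G"
  shows "L2_inner G f (left_regular G h (G_wavelet G k d \<pi> g)) =
    (\<Sum>r\<in>{1..k}. cnj (g r) * coeff_comb r (c r) h)"
proof -
  let ?n = "of_nat (card (carrier G)) :: complex"
  have n0: "?n \<noteq> 0" using card_pos by simp
  have "(\<Sum>x\<in>carrier G. f x * cnj (left_regular G h (G_wavelet G k d \<pi> g) x)) =
      (\<Sum>x\<in>carrier G. (\<Sum>r\<in>{1..k}. coeff_comb r (c r) x) *
        (\<Sum>s\<in>{1..k}. of_nat (d s) * cnj (g s) * cnj (rep_character (\<pi> s) (inv h \<otimes> x))))"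
    using h by (intro sum.cong refl) (simp add: f left_regular_def G_wavelet_def)
  also have "\<dots> = (\<Sum>x\<in>carrier G. \<Sum>r\<in>{1..k}. \<Sum>s\<in>{1..k}. of_nat (d s) * cnj (g s) *
      (coeff_comb r (c r) x * cnj (rep_character (\<pi> s) (inv h \<otimes> x))))"
    by (simp only: sum_product) (simp only: mult_ac)
  also have "\<dots> = (\<Sum>r\<in>{1..k}. \<Sum>x\<in>carrier G. \<Sum>s\<in>{1..k}. of_nat (d s) * cnj (g s) *
      (coeff_comb r (c r) x * cnj (rep_character (\<pi> s) (inv h \<otimes> x))))"
    by (rule sum.swap)
  also have "\<dots> = (\<Sum>r\<in>{1..k}. \<Sum>s\<in>{1..k}. \<Sum>x\<in>carrier G. of_nat (d s) * cnj (g s) *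
      (coeff_comb r (c r) x * cnj (rep_character (\<pi> s) (inv h \<otimes> x))))"
    by (intro sum.cong refl sum.swap)
  also have "\<dots> = (\<Sum>r\<in>{1..k}. \<Sum>s\<in>{1..k}. if r = s then ?n * (cnj (g r) * coeff_comb r (c r) h) else 0)"
  proof (intro sum.cong refl)
    fix r s assume rs: "r \<in> {1..k}" "s \<in> {1..k}"
    show "(\<Sum>x\<in>carrier G. of_nat (d s) * cnj (g s) *
        (coeff_comb r (c r) x * cnj (rep_character (\<pi> s) (inv h \<otimes> x)))) =
      (if r = s then ?n * (cnj (g r) * coeff_comb r (c r) h) else 0)"
      unfolding sum_distrib_left[symmetric] isotypic_projection[OF rs h]
      using degree_pos[OF rs(1)] by auto
  qed
  also have "\<dots> = ?n * (\<Sum>r\<in>{1..k}. cnj (g r) * coeff_comb r (c r) h)"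
    by (simp add: sum.delta sum_distrib_left)
  finally show ?thesis using n0 by (simp add: L2_inner_def)
qed

lemma L2_norm_expansion:
  assumes f: "\<And>x. x \<in> carrier G \<Longrightarrow> f x = (\<Sum>r\<in>{1..k}. coeff_comb r (c r) x)"
  shows "(L2_norm G f)\<^sup>2 = (\<Sum>r\<in>{1..k}. component_energy r (c r))"
proof -
  let ?N = "\<Sum>x\<in>carrier G. (cmod (f x))\<^sup>2"
  have N: "?N = real (card (carrier G)) * (\<Sum>r\<in>{1..k}. component_energy r (c r))"
    using parseval[of "\<lambda>_. 1" c] by (simp add: f)
  have "L2_inner G f f = of_real (?N / real (card (carrier G)))"
    unfolding L2_inner_def complex_norm_square[symmetric] by simp
  then have "Re (L2_inner G f f) = (\<Sum>r\<in>{1..k}. component_energy r (c r))"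
    using card_pos by (simp add: N)
  then show ?thesis
    by (simp add: L2_norm_def sum_nonneg component_energy_nonneg)
qed

lemma frame_energy_expansion:
  assumes f: "\<And>x. x \<in> carrier G \<Longrightarrow> f x = (\<Sum>r\<in>{1..k}. coeff_comb r (c r) x)"
    and "finite I"
  shows "1 / real (card (carrier G)) * (\<Sum>h\<in>carrier G. \<Sum>j\<in>I.
      (cmod (L2_inner G f (left_regular G h (G_wavelet G k d \<pi> (g j)))))\<^sup>2) =
    (\<Sum>r\<in>{1..k}. (\<Sum>j\<in>I. (cmod (g j r))\<^sup>2) * component_energy r (c r))"
proof -
  have "(\<Sum>h\<in>carrier G. \<Sum>j\<in>I.
      (cmod (L2_inner G f (left_regular G h (G_wavelet G k d \<pi> (g j)))))\<^sup>2) =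
    (\<Sum>j\<in>I. \<Sum>h\<in>carrier G. (cmod (\<Sum>r\<in>{1..k}. cnj (g j r) * coeff_comb r (c r) h))\<^sup>2)"
    by (subst sum.swap) (simp add: wavelet_transform[OF f])
  also have "\<dots> = (\<Sum>j\<in>I. real (card (carrier G)) *
      (\<Sum>r\<in>{1..k}. (cmod (g j r))\<^sup>2 * component_energy r (c r)))"
    by (simp only: parseval complex_mod_cnj)
  also have "\<dots> = real (card (carrier G)) *
      (\<Sum>r\<in>{1..k}. (\<Sum>j\<in>I. (cmod (g j r))\<^sup>2) * component_energy r (c r))"
    unfolding sum_distrib_left[symmetric] sum_distrib_right by (subst sum.swap) simp
  finally show ?thesis using card_pos by simp
qed

text \<open>The coefficient arrays of the function \<open>x \<mapsto> \<pi>\<^sup>r(x)\<^sub>0\<^sub>0\<close>, which lies in a single isotypic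
  component.\<close>

lemma single_component_energy:
  assumes r: "r \<in> {1..k}"
  defines "c \<equiv> \<lambda>s i j. if s = r \<and> i = 0 \<and> j = 0 then 1 else (0 :: complex)"
  shows "component_energy s (c s) = (if s = r then 1 / real (d r) else 0)"
proof (cases "s = r")
  case True
  have energy: "(cmod (c r i j))\<^sup>2 = (if i = 0 then if j = 0 then 1 else 0 else 0)" for i j
    by (simp add: c_def)
  have "(\<Sum>i<d r. \<Sum>j<d r. (cmod (c r i j))\<^sup>2) =
      (\<Sum>i<d r. if i = 0 then \<Sum>j<d r. if j = 0 then 1 else 0 else 0)"
    unfolding energy by (intro sum.cong) auto
  also have "\<dots> = 1" using degree_pos[OF r] by simp
  finally show ?thesis using True by (simp add: component_energy_def)
qed (simp add: component_energy_def c_def)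

end


section \<open>The frame criterion\<close>

theorem theorem2p6:
  fixes G :: "('g, 'b) monoid_scheme"
    and k J :: nat
    and d :: "nat \<Rightarrow> nat"
    and \<pi> :: "nat \<Rightarrow> 'g \<Rightarrow> complex mat"
    and \<gamma> :: "nat \<Rightarrow> nat \<Rightarrow> complex"
    and C :: "nat \<Rightarrow> real"
    and A B :: real
  assumes "group G"
    and "finite (carrier G)"
    and "complete_irrep_system G k d \<pi>"
    and C_def: "\<And>r. r \<in> {1..k} \<Longrightarrow> C r = (\<Sum>j\<in>{0..J}. (cmod (\<gamma> j r))\<^sup>2)"
    and "0 < A" and "A \<le> B"
  shows "(\<forall>f\<in>L2_space G.
            A * (L2_norm G f)\<^sup>2
              \<le> 1 / real (card (carrier G)) *
                 (\<Sum>h\<in>carrier G. \<Sum>j\<in>{0..J}.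
                    (cmod (L2_inner G f (left_regular G h (G_wavelet G k d \<pi> (\<gamma> j)))))\<^sup>2)
          \<and> 1 / real (card (carrier G)) *
                 (\<Sum>h\<in>carrier G. \<Sum>j\<in>{0..J}.
                    (cmod (L2_inner G f (left_regular G h (G_wavelet G k d \<pi> (\<gamma> j)))))\<^sup>2)
              \<le> B * (L2_norm G f)\<^sup>2)
     \<longleftrightarrow> (\<forall>r\<in>{1..k}. A \<le> C r \<and> C r \<le> B)"
proof -
  interpret irrep_system G k d \<pi>
    using assms(1-3) by (simp add: irrep_system_def irrep_system_axioms_def)
  let ?F = "\<lambda>f. 1 / real (card (carrier G)) * (\<Sum>h\<in>carrier G. \<Sum>j\<in>{0..J}.
      (cmod (L2_inner G f (left_regular G h (G_wavelet G k d \<pi> (\<gamma> j)))))\<^sup>2)"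
  have F: "?F f = (\<Sum>r\<in>{1..k}. C r * component_energy r (c r))"
    if "\<And>x. x \<in> carrier G \<Longrightarrow> f x = (\<Sum>r\<in>{1..k}. coeff_comb r (c r) x)" for f c
  proof -
    have "?F f = (\<Sum>r\<in>{1..k}. (\<Sum>j\<in>{0..J}. (cmod (\<gamma> j r))\<^sup>2) * component_energy r (c r))"
      by (rule frame_energy_expansion[OF that finite_atLeastAtMost])
    then show ?thesis by (simp only: C_def cong: sum.cong)
  qed
  show ?thesis
  proof (intro iffI ballI)
    (* Test the frame inequality on the matrix coefficient (0, 0) of the representation r. *)
    fix r assume frame: "\<forall>f\<in>L2_space G. A * (L2_norm G f)\<^sup>2 \<le> ?F f \<and> ?F f \<le> B * (L2_norm G f)\<^sup>2"
      and r: "r \<in> {1..k}"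
    define c :: "nat \<Rightarrow> nat \<Rightarrow> nat \<Rightarrow> complex"
      where "c = (\<lambda>s i j. if s = r \<and> i = 0 \<and> j = 0 then 1 else 0)"
    define f where "f = (\<lambda>x\<in>carrier G. \<Sum>s\<in>{1..k}. coeff_comb s (c s) x)"
    have f: "\<And>x. x \<in> carrier G \<Longrightarrow> f x = (\<Sum>s\<in>{1..k}. coeff_comb s (c s) x)"
      by (simp add: f_def)
    have e: "component_energy s (c s) = (if s = r then 1 / real (d r) else 0)" for s
      unfolding c_def by (rule single_component_energy[OF r])
    have "(L2_norm G f)\<^sup>2 = (\<Sum>s\<in>{1..k}. component_energy s (c s))"
      by (rule L2_norm_expansion[OF f])
    then have "(L2_norm G f)\<^sup>2 = 1 / real (d r)"
      unfolding e using r by (simp add: sum.delta)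
    moreover have "?F f = C r * (1 / real (d r))"
    proof -
      have "?F f = (\<Sum>s\<in>{1..k}. C s * component_energy s (c s))"
        by (rule F[OF f])
      also have "\<dots> = (\<Sum>s\<in>{1..k}. if s = r then C r * (1 / real (d r)) else 0)"
        unfolding e by (intro sum.cong) auto
      finally show ?thesis using r by (simp add: sum.delta)
    qed
    moreover have "f \<in> L2_space G" by (auto simp: f_def L2_space_def)
    ultimately have "A * (1 / real (d r)) \<le> C r * (1 / real (d r)) \<and>
        C r * (1 / real (d r)) \<le> B * (1 / real (d r))"
      using frame by metis
    then show "A \<le> C r \<and> C r \<le> B"
      using degree_pos[OF r] by (simp add: divide_le_cancel)
  next
    fix f :: "'g \<Rightarrow> complex" assume C: "\<forall>r\<in>{1..k}. A \<le> C r \<and> C r \<le> B"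
    obtain c where f: "\<And>x. x \<in> carrier G \<Longrightarrow> f x = (\<Sum>r\<in>{1..k}. coeff_comb r (c r) x)"
      using coefficients_complete[of f] unfolding coeff_span_def by blast
    have L: "(L2_norm G f)\<^sup>2 = (\<Sum>r\<in>{1..k}. component_energy r (c r))"
      by (rule L2_norm_expansion[OF f])
    have R: "?F f = (\<Sum>r\<in>{1..k}. C r * component_energy r (c r))"
      by (rule F[OF f])
    show "A * (L2_norm G f)\<^sup>2 \<le> ?F f \<and> ?F f \<le> B * (L2_norm G f)\<^sup>2"
      unfolding L R
      unfolding sum_distrib_left
      using C by (auto intro!: sum_mono mult_right_mono component_energy_nonneg)
  qed
qed

end
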